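(* Let $n\ge m\ge 1$ and let $(A_s,B_s)$, $A_s\in\mathbb{R}^{n\times n}$, $B_s\in\mathbb{R}^{n\times m}$, be in staircase form with block sizes $m=\omega_1\ge\omega_2\ge\dots\ge\omega_\mu\ge 1$, $\sum_{i=1}^{\mu}\omega_i=n$, and let $\mu_1\ge\mu_2\ge\dots\ge\mu_m\ge 1$ be its controllability indices. Put $\omega_0=m$, $\omega_{\mu+1}=0$, $\epsilon_i=\omega_i-\omega_{i+1}$, and let $\mu=k_1>k_2>\dots>k_g$ be all the indices $i$ with $\epsilon_i>0$. Let $$\mathcal{O}=\{C\in\mathbb{R}^{m\times n} \mid (A_s,B_s,C)\text{ is decouplable and its decoupling indices satisfy }\alpha_i=\mu_i\ \ \forall i\in\{1,\dots,m\}\}.$$ Then $\mathcal{O}$ is exactly the set of all matrices of the form $$C=\begin{bmatrix}C_1\\ \vdots\\ C_g\end{bmatrix},\qquad C_j=\begin{bmatrix}0_{\epsilon_{k_j}\times(\omega_1+\dots+\omega_{k_j-1})} & S^r_{k_j} & S^f_{k_j}\end{bmatrix}\in\mathbb{R}^{\epsilon_{k_j}\times n},\qquad j=1,\dots,g,$$ where $S^r_{k_j}\in\mathbb{R}^{\epsilon_{k_j}\times\omega_{k_j}}$ are such that the $g$ square matrices $$S^r_{k_1},\qquad \begin{bmatrix}A^s_{k_j+1,k_j}\\ S^r_{k_j}\end{bmatrix}\in\mathbb{R}^{\omega_{k_j}\times\omega_{k_j}},\quad j=2,3,\dots,g,$$ are all invertible, and the matrices $S^f_{k_j}\in\mathbb{R}^{\epsilon_{k_j}\times\sum_{i=k_j+1}^{\mu}\omega_i}$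 are arbitrary.
   Context: Staircase form: a pair $(A_s,B_s)$ is in staircase form with block sizes $m=\omega_1\ge\dots\ge\omega_\mu\ge1$, $\sum_{i=1}^\mu\omega_i=n$, $\omega_0:=m$, if $A_s=[A^s_{ij}]_{i,j=1}^{\mu}$ with blocks $A^s_{ij}\in\mathbb{R}^{\omega_i\times\omega_j}$ satisfying $A^s_{ij}=0$ for $i>j+1$; $B_s=\begin{bmatrix}A^s_{10}\\0\\ \vdots\\0\end{bmatrix}$ with $A^s_{10}\in\mathbb{R}^{\omega_1\times\omega_0}=\mathbb{R}^{m\times m}$; and $\operatorname{rank}A^s_{i,i-1}=\omega_i$ for $i=1,\dots,\mu$. (Such a pair is controllable.) Controllability indices: for a controllable pair $(A,B)$ with $B=[b_1\ \cdots\ b_m]$ of full column rank, select the first $n$ linearly independent columns of $[b_1\ \cdots\ b_m\ Ab_1\ \cdots\ Ab_m\ \cdots\ A^{n-1}b_1\ \cdots\ A^{n-1}b_m]$ from left to right; the numbers of selected columns involving $b_1,\dots,b_m$, arranged in descending order, are the controllability indices $\mu_1\ge\dots\ge\mu_m\ge1$, and $\sum_i\mu_i=n$. For a staircase pair they form the partition of $n$ conjugate to $(\omega_1,\dots,\omega_\mu)$, i.e. $\mu_i=\#\{l:\omega_l\ge i\}$; in particular $\mu=\mu_1$, the distinct values of the $\mu_i$ are $k_1,\dots,k_g$, and the value $k_j$ occurs $\epsilon_{k_j}$ times. Decouplability: for a triplet $(A,B,C)$ with $A\in\mathbb{R}^{n\times n}$, $B\in\mathbb{R}^{n\times m}$,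 $C\in\mathbb{R}^{m\times n}$ with rows $c_1,\dots,c_m$, the decoupling indices are $\alpha_i=\min\{k\in\{1,\dots,n\}: c_iA^{k-1}B\ne0\}$. The decoupling matrix $D\in\mathbb{R}^{m\times m}$ has $i$-th row $c_iA^{\alpha_i-1}B$. The triplet is decouplable if (all $\alpha_i$ exist and) $D$ is nonsingular. *)

theory Defs
  imports "Jordan_Normal_Form.DL_Rank"
begin

text \<open>
  Block indices and the values of \<open>\<omega>\<close>, \<open>k\<close>, \<open>\<alpha>\<close> are 1-based, as usual on paper; rows and columns
  inside a matrix, and the lists below, are 0-based, as in the matrix library. Row and column
  number \<open>r\<close> of block \<open>i \<ge> 1\<close> thus sits at position \<open>offs \<omega> i + r\<close>.
\<close>

definition offs :: "(nat \<Rightarrow> nat) \<Rightarrow> nat \<Rightarrow> nat" where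
  "offs \<omega> i = (\<Sum>l\<in>{1..<i}. \<omega> l)"

text \<open>The block \<open>A\<^sub>i\<^sub>j\<close> of \<open>A\<close>, for \<open>i, j \<ge> 1\<close>.\<close>

definition block :: "(nat \<Rightarrow> nat) \<Rightarrow> real mat \<Rightarrow> nat \<Rightarrow> nat \<Rightarrow> real mat" where
  "block \<omega> A i j = mat (\<omega> i) (\<omega> j) (\<lambda>(r, c). A $$ (offs \<omega> i + r, offs \<omega> j + c))"

text \<open>
  The block \<open>A\<^sub>1\<^sub>0\<close> is the top part of \<open>B\<close>. Since \<^const>\<open>vec_space.rank\<close> takes the number of rows
  as a parameter, that parameter is the block height \<open>\<omega> i\<close>.
\<close>

definition staircase_form ::
  "nat \<Rightarrow> nat \<Rightarrow> nat \<Rightarrow> (nat \<Rightarrow> nat) \<Rightarrow> real mat \<Rightarrow> real mat \<Rightarrow> bool" where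
  "staircase_form n m \<mu> \<omega> A B \<longleftrightarrow>
     A \<in> carrier_mat n n \<and> B \<in> carrier_mat n m \<and>
     1 \<le> \<mu> \<and> \<omega> 0 = m \<and> \<omega> 1 = m \<and>
     (\<forall>i\<in>{1..<\<mu>}. \<omega> (i + 1) \<le> \<omega> i) \<and> 1 \<le> \<omega> \<mu> \<and>
     (\<Sum>i=1..\<mu>. \<omega> i) = n \<and>
     (\<forall>i\<in>{1..\<mu>}. \<forall>j\<in>{1..\<mu>}. i > j + 1 \<longrightarrow> block \<omega> A i j = 0\<^sub>m (\<omega> i) (\<omega> j)) \<and>
     (\<exists>A10 \<in> carrier_mat (\<omega> 1) (\<omega> 0).
        B = A10 @\<^sub>r 0\<^sub>m (n - \<omega> 1) m \<and> vec_space.rank (\<omega> 1) A10 = \<omega> 1) \<and>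
     (\<forall>i\<in>{2..\<mu>}. vec_space.rank (\<omega> i) (block \<omega> A i (i - 1)) = \<omega> i)"

text \<open>Column \<open>l * m + j\<close> of \<open>[B, A B, \<dots>, A\<^sup>n\<^sup>-\<^sup>1 B]\<close> is \<open>A\<^sup>l\<close> applied to column \<open>j\<close> of \<open>B\<close>.\<close>

definition ctrl_mat :: "nat \<Rightarrow> nat \<Rightarrow> real mat \<Rightarrow> real mat \<Rightarrow> real mat" where
  "ctrl_mat n m A B = mat n (n * m) (\<lambda>(r, p). (A ^\<^sub>m (p div m) * B) $$ (r, p mod m))"

text \<open>
  Left-to-right selection keeps a column iff it is not in the span of the columns before it. There
  are never more than \<open>n\<close> such columns, and exactly \<open>n\<close> if the pair is controllable, so these are
  the first \<open>n\<close> linearly independent columns.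
\<close>

definition selected_cols :: "nat \<Rightarrow> nat \<Rightarrow> real mat \<Rightarrow> real mat \<Rightarrow> nat set" where
  "selected_cols n m A B =
     {p. p < n * m \<and>
         col (ctrl_mat n m A B) p \<notin>
           LinearCombinations.module.span class_ring (module_vec TYPE(real) n)
             (col (ctrl_mat n m A B) ` {..<p})}"

text \<open>The controllability index \<open>\<mu>\<^sub>i\<close> is entry \<open>i - 1\<close> of this list of length \<open>m\<close>.\<close>

definition controllability_indices :: "nat \<Rightarrow> nat \<Rightarrow> real mat \<Rightarrow> real mat \<Rightarrow> nat list" where
  "controllability_indices n m A B =
     rev (sort (map (\<lambda>j. card {p \<in> selected_cols n m A B. p mod m = j}) [0..<m]))"

text \<open>
  Row \<open>i\<close> of \<open>C A\<^sup>k\<^sup>-\<^sup>1 B\<close> is \<open>c A\<^sup>k\<^sup>-\<^sup>1 B\<close> for the row \<open>c\<close> of \<open>C\<close> with number \<open>i\<close>.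
  \<open>decoupling_index\<close> is meaningful only if the set of candidates is nonempty, which
  \<open>decouplable\<close> requires.
\<close>

definition decoupling_candidates ::
  "nat \<Rightarrow> nat \<Rightarrow> real mat \<Rightarrow> real mat \<Rightarrow> real mat \<Rightarrow> nat \<Rightarrow> nat set" where
  "decoupling_candidates n m A B C i =
     {k \<in> {1..n}. row (C * A ^\<^sub>m (k - 1) * B) i \<noteq> 0\<^sub>v m}"

definition decoupling_index ::
  "nat \<Rightarrow> nat \<Rightarrow> real mat \<Rightarrow> real mat \<Rightarrow> real mat \<Rightarrow> nat \<Rightarrow> nat" where
  "decoupling_index n m A B C i = Min (decoupling_candidates n m A B C i)"

definition decoupling_mat ::
  "nat \<Rightarrow> nat \<Rightarrow> real mat \<Rightarrow> real mat \<Rightarrow> real mat \<Rightarrow> real mat" where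
  "decoupling_mat n m A B C =
     mat\<^sub>r m m (\<lambda>i. row (C * A ^\<^sub>m (decoupling_index n m A B C i - 1) * B) i)"

definition decouplable ::
  "nat \<Rightarrow> nat \<Rightarrow> real mat \<Rightarrow> real mat \<Rightarrow> real mat \<Rightarrow> bool" where
  "decouplable n m A B C \<longleftrightarrow>
     (\<forall>i<m. decoupling_candidates n m A B C i \<noteq> {}) \<and>
     invertible_mat (decoupling_mat n m A B C)"

definition append_cols :: "real mat \<Rightarrow> real mat \<Rightarrow> real mat" (infixr \<open>@\<^sub>c\<close> 66) where
  "X @\<^sub>c Y = four_block_mat X Y (0\<^sub>m 0 (dim_col X)) (0\<^sub>m 0 (dim_col Y))"

definition stack_rows :: "nat \<Rightarrow> real mat list \<Rightarrow> real mat" where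
  "stack_rows n Ms = foldr (@\<^sub>r) Ms (0\<^sub>m 0 n)"

end

theory Submission
  imports Defs
begin

text \<open>
  Let \<open>P\<^sub>t\<close> be the \<open>t\<close>-th block row of \<open>A\<^sup>t\<^sup>-\<^sup>1 B\<close>. Since \<open>A\<close> is block Hessenberg and only the top block
  of \<open>B\<close> is nonzero, the blocks of \<open>A\<^sup>t\<^sup>-\<^sup>1 B\<close> below \<open>P\<^sub>t\<close> vanish and \<open>P\<^sub>t\<^sub>+\<^sub>1\<close> is the subdiagonal block in
  block row \<open>t + 1\<close> times \<open>P\<^sub>t\<close> (\<open>ctrl_power_below\<close>, \<open>lead_block_Suc\<close>). All subdiagonal
  blocks have full row rank, so \<open>P\<^sub>t\<close> is onto (\<open>lead_block_surj\<close>). Everything rests on these facts.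

  Controllability indices. The columns of \<open>B, \<dots>, A\<^sup>l\<^sup>-\<^sup>1 B\<close> span exactly the vectors supported on the
  first \<open>l \<le> \<mu>\<close> blocks, so \<open>\<omega> l\<close> columns of \<open>A\<^sup>l\<^sup>-\<^sup>1 B\<close> are selected. The powers selected for one input
  form an initial segment, so the controllability indices are the partition conjugate to the block
  sizes: the rows \<open>i\<close> (from 0) with index \<open>t\<close> are those with \<open>\<omega> (t + 1) \<le> i < \<omega> t\<close>
  (\<open>controllability_index_eq\<close>).

  Decoupling indices. A row \<open>c\<close> satisfies \<open>c A\<^sup>l\<^sup>-\<^sup>1 B = 0\<close> for all \<open>l < t\<close> iff it vanishes on the
  first \<open>t - 1\<close> blocks (\<open>prod_row_below_lead\<close>, \<open>row_zero_prefix\<close>), and then \<open>c A\<^sup>t\<^sup>-\<^sup>1 B = s P\<^sub>t\<close> for its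
  \<open>t\<close>-th block \<open>s\<close>. Hence if the two kinds of indices agree, \<open>C\<close> has the prescribed zeros and the
  decoupling matrix consists of the rows \<open>s P\<^sub>t\<close>.

  Nonsingularity. Let \<open>S\<^sub>t\<close> collect the leading blocks \<open>s\<close> of the rows with index \<open>t\<close>. Pulling the
  subdiagonal blocks out of the rows one level at a time shows that the first \<open>\<omega> t\<close> rows of the
  decoupling matrix are \<open>T\<^sub>t P\<^sub>t\<close>, where \<open>T\<^sub>t\<close> is the block diagonal matrix with blocks \<open>T\<^sub>t\<^sub>+\<^sub>1\<close> and \<open>1\<close>
  times the \<open>t\<close>-th bordered block, which is the subdiagonal block in block row \<open>t + 1\<close> with \<open>S\<^sub>t\<close> below
  it (\<open>lead_rows_factor\<close>). Since \<open>P\<^sub>1\<close> is invertible, the decoupling matrix is nonsingular iff all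
  bordered blocks are. Those at levels without rows are nonsingular anyway
  (\<open>det_bordered_block_flat\<close>), and the remaining ones are the \<open>g\<close> matrices of the theorem, since at
  level \<open>\<mu> = k 1\<close> only \<open>S\<^sub>\<mu>\<close> is left. In particular a nonsingular decoupling matrix has no zero
  row, so that every index is attained where it should be.
\<close>

section \<open>Rank, spans and pivots\<close>

lemma invertible_mat_iff_det:
  fixes X :: "'a :: field mat"
  assumes X: "X \<in> carrier_mat r r"
  shows "invertible_mat X \<longleftrightarrow> det X \<noteq> 0"
proof
  assume "invertible_mat X"
  then obtain Y where XY: "X * Y = 1\<^sub>m r" and YX: "Y * X = 1\<^sub>m (dim_row Y)"
    using X unfolding invertible_mat_def inverts_mat_def by auto
  have "dim_col Y = r" using arg_cong[OF XY, of dim_col] by simp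
  moreover have "dim_row Y = r" using arg_cong[OF YX, of dim_col] X by simp
  ultimately have "det X * det Y = 1"
    using det_mult[OF X, of Y] XY by auto
  then show "det X \<noteq> 0" by auto
next
  assume "det X \<noteq> 0"
  from det_non_zero_imp_unit[OF X this] show "invertible_mat X"
    using X unfolding Units_def invertible_mat_def inverts_mat_def
    by (auto simp: ring_mat_simps)
qed

lemma det_eq_0_if_row_eq_0:
  fixes X :: "'a :: comm_ring_1 mat"
  assumes "row X i = 0\<^sub>v r" and X: "X \<in> carrier_mat r r" and i: "i < r"
  shows "det X = 0"
proof -
  have "X = mat\<^sub>r r r (\<lambda>i'. if i' = i then 0\<^sub>v r else row X i')"
    by (rule eq_rowI) (use assms in \<open>auto intro!: eq_vecI\<close>)
  also have "det \<dots> = 0" using i X by (intro det_row_0) auto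
  finally show ?thesis .
qed

text \<open>
  Surjectivity is the form in which full row rank is passed on to the leading blocks: unlike the
  rank itself it is trivially inherited by products, and it gives a trivial left kernel.
\<close>

lemma full_row_rank_surj:
  fixes X :: "'a :: field mat"
  assumes X: "X \<in> carrier_mat r c" and rk: "vec_space.rank r X = r" and v: "v \<in> carrier_vec r"
  obtains u where "u \<in> carrier_vec c" "X *\<^sub>v u = v"
proof -
  interpret V: vec_space "TYPE('a)" r .
  have cols: "set (cols X) \<subseteq> carrier_vec r" using cols_dim X by blast
  obtain U where U: "maximal U (\<lambda>T. T \<subseteq> set (cols X) \<and> V.lin_indpt T)"
    using maximal_exists_superset[of "set (cols X)" "\<lambda>T. T \<subseteq> set (cols X) \<and> V.lin_indpt T" "{}"]
      V.finite_lin_indpt2[of "{}"] by blast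
  then have Us: "U \<subseteq> set (cols X)" and li: "V.lin_indpt U" by (auto simp: maximal_def)
  have "V.basis U"
  proof (rule V.dim_li_is_basis[OF V.fin_dim _ _ li])
    show "finite U" using Us finite_subset by blast
    show "U \<subseteq> carrier_vec r" using Us cols by blast
    show "V.dim \<le> card U" using V.rank_card_indpt[OF X U] rk V.dim_is_n by simp
  qed
  then have "carrier_vec r = V.span U" unfolding V.basis_def by auto
  also have "\<dots> \<subseteq> V.col_space X" using V.span_is_monotone[OF Us] unfolding V.col_space_def .
  finally have "v \<in> V.col_space X" using v by blast
  then show thesis using that X unfolding V.col_space_eq[OF X] by auto
qed

text \<open>
  The vectors satisfying a linear condition form a subspace, so the condition passes from a set to
  its span. It is used for "coordinate \<open>i\<close> vanishes" and for "the image lies in a given span".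
\<close>

lemma (in vec_space) span_induct:
  assumes S: "S \<subseteq> carrier_vec n" and v: "v \<in> span S"
    and mem: "\<And>x. x \<in> S \<Longrightarrow> Q x" and zero: "Q (0\<^sub>v n)"
    and add: "\<And>x y. x \<in> carrier_vec n \<Longrightarrow> y \<in> carrier_vec n \<Longrightarrow> Q x \<Longrightarrow> Q y \<Longrightarrow> Q (x + y)"
    and smult: "\<And>a x. x \<in> carrier_vec n \<Longrightarrow> Q x \<Longrightarrow> Q (a \<cdot>\<^sub>v x)"
  shows "Q v"
proof -
  have "submodule class_ring {x \<in> carrier_vec n. Q x} V"
    using zero add smult by (unfold_locales) auto
  from span_is_subset[OF _ this, of S] show ?thesis using S v mem by auto
qed

text \<open>
  Scanning a spanning sequence from left to right and keeping each vector that is not in the span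
  of its predecessors produces a basis: an invariant of the scan is that the kept vectors are
  independent and span the same subspace as all vectors seen so far.
\<close>

lemma (in vec_space) card_pivots:
  fixes f :: "nat \<Rightarrow> 'a vec"
  assumes f: "\<And>p. p < N \<Longrightarrow> f p \<in> carrier_vec n"
    and sp: "span (f ` {..<N}) = carrier_vec n"
  shows "card {p. p < N \<and> f p \<notin> span (f ` {..<p})} = n"
proof -
  define P where "P k = {p. p < k \<and> f p \<notin> span (f ` {..<p})}" for k
  have fin: "finite (P k)" for k by (rule finite_subset[of _ "{..<k}"]) (auto simp: P_def)
  have main: "inj_on f (P k) \<and> lin_indpt (f ` P k) \<and> span (f ` P k) = span (f ` {..<k})"
    if "k \<le> N" for k
    using that
  proof (induction k)
    case 0
    then show ?case using finite_lin_indpt2[of "{}"] by (simp add: P_def)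
  next
    case (Suc k)
    then have inj: "inj_on f (P k)" and li: "lin_indpt (f ` P k)"
      and s: "span (f ` P k) = span (f ` {..<k})" and k: "k < N" by auto
    have c: "f ` {..<k} \<subseteq> carrier_vec n" "f ` P k \<subseteq> carrier_vec n" "f k \<in> carrier_vec n"
      using f k by (auto simp: P_def)
    have ins: "f ` {..<Suc k} = insert (f k) (f ` {..<k})" by (auto simp: lessThan_Suc)
    show ?case
    proof (cases "f k \<in> span (f ` {..<k})")
      case True
      then have P: "P (Suc k) = P k" unfolding P_def by (auto simp: less_Suc_eq)
      have "span (f ` {..<Suc k}) \<subseteq> span (f ` {..<k})"
        unfolding ins by (rule span_subsetI) (use c True in_own_span in auto)
      moreover have "span (f ` {..<k}) \<subseteq> span (f ` {..<Suc k})"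
        by (rule span_is_monotone) auto
      ultimately show ?thesis using inj li s P by auto
    next
      case False
      then have P: "P (Suc k) = insert k (P k)" unfolding P_def by (auto simp: less_Suc_eq)
      have nin: "f k \<notin> f ` P k" using False s c(2) span_mem[of "f ` P k"] by auto
      have "lin_indpt (f ` P k \<union> {f k})"
        using lin_dep_iff_in_span[OF c(2) li c(3) nin] False s by auto
      moreover have "inj_on f (P (Suc k))"
        using inj nin unfolding P by (auto simp: P_def)
      moreover have "span (f ` P (Suc k)) = span (f ` {..<Suc k})"
      proof
        show "span (f ` P (Suc k)) \<subseteq> span (f ` {..<Suc k})"
          by (rule span_is_monotone) (auto simp: P_def)
        have "f ` {..<k} \<subseteq> span (f ` P k)" unfolding s using c(1) by (rule in_own_span)
        also have "\<dots> \<subseteq> span (f ` P (Suc k))"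
          by (rule span_is_monotone) (auto simp: P)
        finally have "f ` {..<Suc k} \<subseteq> span (f ` P (Suc k))"
          unfolding ins using c span_mem[of "f ` P (Suc k)" "f k"] by (auto simp: P)
        then show "span (f ` {..<Suc k}) \<subseteq> span (f ` P (Suc k))"
          by (rule span_subsetI[rotated]) (use c in \<open>auto simp: P\<close>)
      qed
      ultimately show ?thesis by (simp add: P)
    qed
  qed
  from main[of N] have inj: "inj_on f (P N)" and li: "lin_indpt (f ` P N)"
    and s: "span (f ` P N) = carrier_vec n" using sp by auto
  have "basis (f ` P N)"
    unfolding basis_def using li s f by (auto simp: P_def)
  then have "card (f ` P N) = n" using dim_basis[of "f ` P N"] fin dim_is_n by auto
  then show ?thesis using card_image[OF inj] unfolding P_def by simp
qed

lemma (in vec_space) mult_mat_vec_span: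
  assumes X: "X \<in> carrier_mat n n" and S: "S \<subseteq> carrier_vec n" and v: "v \<in> span S"
    and T: "T \<subseteq> carrier_vec n" and img: "\<And>x. x \<in> S \<Longrightarrow> X *\<^sub>v x \<in> span T"
  shows "X *\<^sub>v v \<in> span T"
  using S v
proof (rule span_induct)
  have "X *\<^sub>v 0\<^sub>v n = 0\<^sub>v n" using X by auto
  then show "X *\<^sub>v 0\<^sub>v n \<in> span T" using vectorspace.span_zero[OF vectorspace_axioms, of T] by simp
  show "X *\<^sub>v (x + y) \<in> span T" if "x \<in> carrier_vec n" "y \<in> carrier_vec n"
    "X *\<^sub>v x \<in> span T" "X *\<^sub>v y \<in> span T" for x y
    using that span_add1[OF T that(3,4)] mult_add_distrib_mat_vec[OF X that(1,2)] by simp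
  show "X *\<^sub>v (a \<cdot>\<^sub>v x) \<in> span T" if "x \<in> carrier_vec n" "X *\<^sub>v x \<in> span T" for a x
    using smult_in_span[OF T that(2)] mult_mat_vec[OF X that(1)] by simp
qed (use img in auto)

section \<open>Stacking matrices\<close>

lemma index_append_rows:
  assumes "X \<in> carrier_mat r1 c" "Y \<in> carrier_mat r2 c" "i < r1 + r2" "j < c"
  shows "(X @\<^sub>r Y) $$ (i, j) = (if i < r1 then X $$ (i, j) else Y $$ (i - r1, j))"
  using assms unfolding append_rows_def by auto

lemma append_rows_mult:
  fixes X :: "'a :: semiring_0 mat"
  assumes X: "X \<in> carrier_mat r1 k" and Y: "Y \<in> carrier_mat r2 k" and W: "W \<in> carrier_mat k c"
  shows "(X @\<^sub>r Y) * W = X * W @\<^sub>r Y * W"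
proof (rule eq_matI)
  have XY: "X @\<^sub>r Y \<in> carrier_mat (r1 + r2) k" using X Y by auto
  have XYW: "X * W @\<^sub>r Y * W \<in> carrier_mat (r1 + r2) c" using X Y W by auto
  show "dim_row ((X @\<^sub>r Y) * W) = dim_row (X * W @\<^sub>r Y * W)"
       "dim_col ((X @\<^sub>r Y) * W) = dim_col (X * W @\<^sub>r Y * W)" using XY XYW W by auto
  fix i j assume "i < dim_row (X * W @\<^sub>r Y * W)" "j < dim_col (X * W @\<^sub>r Y * W)"
  then have i: "i < r1 + r2" and j: "j < c" using XYW by auto
  show "((X @\<^sub>r Y) * W) $$ (i, j) = (X * W @\<^sub>r Y * W) $$ (i, j)"
    using X Y W carrier_matD[OF XY] i j
    by (subst index_append_rows[of _ r1 c _ r2])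
       (auto simp: scalar_prod_def index_append_rows[of X r1 k Y r2] row_def intro!: sum.cong)
qed

text \<open>
  The matrix on the left is the block diagonal matrix with blocks \<open>T\<close> and \<open>1\<close> times the matrix
  \<open>X\<close> over \<open>S\<close>.
\<close>

lemma det_mult_append_rows:
  fixes T :: "'a :: idom mat"
  assumes T: "T \<in> carrier_mat a a" and X: "X \<in> carrier_mat a (a + b)" and S: "S \<in> carrier_mat b (a + b)"
  shows "det (T * X @\<^sub>r S) = det T * det (X @\<^sub>r S)"
proof -
  let ?D = "four_block_mat T (0\<^sub>m a b) (0\<^sub>m b a) (1\<^sub>m b)"
  have "?D * (X @\<^sub>r S) = T * X @\<^sub>r S"
    unfolding append_rows_def using T X S
    by (subst mult_four_block_mat[of _ a a _ b _ b _ _ "a + b" _ 0]) auto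
  moreover have "det (?D * (X @\<^sub>r S)) = det ?D * det (X @\<^sub>r S)"
    using T X S by (intro det_mult[of _ "a + b"]) auto
  moreover have "det ?D = det T"
    using det_four_block_mat_upper_right_zero[OF T refl, of "0\<^sub>m b a" b "1\<^sub>m b"] by simp
  ultimately show ?thesis by simp
qed

lemma index_append_cols:
  assumes "X \<in> carrier_mat r c1" "Y \<in> carrier_mat r c2" "i < r" "j < c1 + c2"
  shows "(X @\<^sub>c Y) $$ (i, j) = (if j < c1 then X $$ (i, j) else Y $$ (i, j - c1))"
  using assms unfolding append_cols_def by auto

lemma carrier_append_cols:
  assumes "X \<in> carrier_mat r c1" "Y \<in> carrier_mat r c2"
  shows "X @\<^sub>c Y \<in> carrier_mat r (c1 + c2)"
  using assms unfolding append_cols_def by auto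

lemma stack_rows_upt:
  assumes F: "\<And>l. l \<in> {a..<b} \<Longrightarrow> F l \<in> carrier_mat (h l) n" and "a \<le> b"
  shows "stack_rows n (map F [a..<b]) \<in> carrier_mat (\<Sum>l\<in>{a..<b}. h l) n \<and>
    (\<forall>l\<in>{a..<b}. \<forall>r<h l. \<forall>c<n.
       stack_rows n (map F [a..<b]) $$ ((\<Sum>l'\<in>{a..<l}. h l') + r, c) = F l $$ (r, c))"
  using \<open>a \<le> b\<close> F
proof (induction a rule: inc_induct)
  case base
  then show ?case by (simp add: stack_rows_def)
next
  case (step a)
  let ?R = "stack_rows n (map F [Suc a..<b])"
  from step have R: "?R \<in> carrier_mat (\<Sum>l\<in>{Suc a..<b}. h l) n"
    and ent: "\<And>l r c. l \<in> {Suc a..<b} \<Longrightarrow> r < h l \<Longrightarrow> c < n \<Longrightarrow>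
       ?R $$ ((\<Sum>l'\<in>{Suc a..<l}. h l') + r, c) = F l $$ (r, c)" by auto
  have Fa: "F a \<in> carrier_mat (h a) n" using step by auto
  have eq: "stack_rows n (map F [a..<b]) = F a @\<^sub>r ?R"
    using step by (simp add: upt_conv_Cons stack_rows_def)
  have sum: "(\<Sum>l'\<in>{a..<l}. h l') = h a + (\<Sum>l'\<in>{Suc a..<l}. h l')" if "a < l" for l
    using that by (simp add: sum.atLeast_Suc_lessThan)
  have "stack_rows n (map F [a..<b]) $$ ((\<Sum>l'\<in>{a..<l}. h l') + r, c) = F l $$ (r, c)"
    if l: "l \<in> {a..<b}" and r: "r < h l" and c: "c < n" for l r c
  proof (cases "l = a")
    case True
    then show ?thesis unfolding eq
      using r c by (simp add: index_append_rows[OF Fa R])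
  next
    case False
    then have l': "l \<in> {Suc a..<b}" using l by auto
    have "(\<Sum>l'\<in>{Suc a..<l}. h l') + r < (\<Sum>l'\<in>{Suc a..<Suc l}. h l')"
      using l' r by simp
    also have "\<dots> \<le> (\<Sum>l'\<in>{Suc a..<b}. h l')"
      by (rule sum_mono2) (use l' in auto)
    finally show ?thesis unfolding eq
      using l' c ent[OF l' r c] sum[of l] by (subst index_append_rows[OF Fa R]) auto
  qed
  then show ?case using eq Fa R sum[of b] step(2) by auto
qed

section \<open>Conjugate partitions\<close>

text \<open>
  For the descending list \<open>ys\<close> of the entries of \<open>xs\<close>, more than \<open>i\<close> entries exceed \<open>l\<close> exactly
  when \<open>ys ! i\<close> does. So the entries of \<open>ys\<close> are the parts of the partition conjugate to
  the counts on the right.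
\<close>

lemma sorted_conjugate:
  fixes xs :: "nat list"
  assumes i: "i < length xs"
  shows "rev (sort xs) ! i = card {l. i < card {j. j < length xs \<and> l < xs ! j}}"
proof -
  define ys where "ys = rev (sort xs)"
  have len: "length ys = length xs" unfolding ys_def by simp
  have desc: "ys ! b \<le> ys ! a" if "a \<le> b" "b < length ys" for a b
    by (rule sorted_rev_nth_mono) (use that in \<open>auto simp: ys_def\<close>)
  have "card {j. j < length xs \<and> l < xs ! j} = length (filter (\<lambda>x. l < x) xs)" for l
    by (simp add: length_filter_conv_card)
  also have "\<dots> l = length (filter (\<lambda>x. l < x) ys)" for l
  proof -
    have "mset (filter (\<lambda>x. l < x) ys) = mset (filter (\<lambda>x. l < x) xs)" by (simp add: ys_def)
    then show ?thesis by (metis mset_eq_length)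
  qed
  also have "\<dots> l = card {j. j < length ys \<and> l < ys ! j}" for l
    by (simp add: length_filter_conv_card)
  finally have card: "card {j. j < length xs \<and> l < xs ! j} = card {j. j < length ys \<and> l < ys ! j}" for l .
  have "i < card {j. j < length ys \<and> l < ys ! j} \<longleftrightarrow> l < ys ! i" for l
  proof
    assume a: "l < ys ! i"
    have "{..i} \<subseteq> {j. j < length ys \<and> l < ys ! j}"
      using a i len desc by (auto intro: less_le_trans)
    then have "card {..i} \<le> card {j. j < length ys \<and> l < ys ! j}"
      by (rule card_mono[rotated]) auto
    then show "i < card {j. j < length ys \<and> l < ys ! j}" by simp
  next
    assume a: "i < card {j. j < length ys \<and> l < ys ! j}"
    show "l < ys ! i"
    proof (rule ccontr)
      assume n: "\<not> l < ys ! i"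
      have "{j. j < length ys \<and> l < ys ! j} \<subseteq> {..<i}"
      proof
        fix j assume "j \<in> {j. j < length ys \<and> l < ys ! j}"
        then show "j \<in> {..<i}" using n desc[of i j] by (cases "i \<le> j") auto
      qed
      from card_mono[OF _ this] a show False by simp
    qed
  qed
  then have "{l. i < card {j. j < length xs \<and> l < xs ! j}} = {..<ys ! i}"
    unfolding card by auto
  then show ?thesis unfolding ys_def by simp
qed

lemma downward_closed_eq_lessThan:
  fixes S :: "nat set"
  assumes fin: "finite S" and down: "\<And>l. Suc l \<in> S \<Longrightarrow> l \<in> S"
  shows "S = {..<card S}"
proof -
  have closed: "a \<in> S" if "b \<in> S" "a \<le> b" for a b
    using that(2,1) by (induction rule: inc_induct) (auto intro: down)
  obtain k where "k \<notin> S" using fin infinite_UNIV_nat by (metis UNIV_eq_I)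
  define k0 where "k0 = (LEAST k. k \<notin> S)"
  have "k0 \<notin> S" unfolding k0_def using \<open>k \<notin> S\<close> by (rule LeastI)
  then have "S = {..<k0}"
    using closed not_less_Least[of _ "\<lambda>k. k \<notin> S"] unfolding k0_def[symmetric]
    by (auto simp: k0_def[symmetric] not_less[symmetric])
  then show ?thesis by simp
qed

section \<open>The leading blocks of a staircase pair\<close>

locale staircase_pair =
  fixes n m \<mu> :: nat and \<omega> :: "nat \<Rightarrow> nat" and A B :: "real mat"
  assumes form: "staircase_form n m \<mu> \<omega> A B"
    and omega_beyond: "\<omega> (\<mu> + 1) = 0"
begin

lemma A_carrier: "A \<in> carrier_mat n n" and B_carrier: "B \<in> carrier_mat n m"
  and mu_pos: "1 \<le> \<mu>" and omega_1: "\<omega> 1 = m"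
  and sum_omega: "(\<Sum>i=1..\<mu>. \<omega> i) = n"
  using form unfolding staircase_form_def by auto

lemma omega_antimono:
  assumes "1 \<le> i" "i \<le> j" "j \<le> \<mu> + 1"
  shows "\<omega> j \<le> \<omega> i"
  using assms(2,3,1)
proof (induction rule: dec_induct)
  case (step j)
  then have "\<omega> (Suc j) \<le> \<omega> j"
    using form omega_beyond unfolding staircase_form_def by (cases "j = \<mu>") auto
  with step show ?case by simp
qed simp

lemma omega_pos:
  assumes "i \<in> {1..\<mu>}"
  shows "1 \<le> \<omega> i"
  using omega_antimono[of i \<mu>] assms form unfolding staircase_form_def by auto

lemma offs_1: "offs \<omega> 1 = 0"
  by (simp add: offs_def)

lemma offs_Suc: "1 \<le> i \<Longrightarrow> offs \<omega> (i + 1) = offs \<omega> i + \<omega> i"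
  by (simp add: offs_def)

lemma offs_top: "offs \<omega> (\<mu> + 1) = n"
  using sum_omega by (simp add: offs_def atLeastLessThanSuc_atLeastAtMost)

lemma offs_mono: "i \<le> j \<Longrightarrow> offs \<omega> i \<le> offs \<omega> j"
  unfolding offs_def by (rule sum_mono2) auto

lemma offs_le_n: "t \<le> \<mu> + 1 \<Longrightarrow> offs \<omega> t \<le> n"
  using offs_mono[of t "\<mu> + 1"] offs_top by simp

lemma mu_le_n: "\<mu> \<le> n"
  using sum_mono[of "{1..\<mu>}" "\<lambda>_. 1" \<omega>] omega_pos sum_omega by simp

lemma coordinate_in_block:
  assumes "q < offs \<omega> (t + 1)" "1 \<le> t"
  obtains i where "i \<in> {1..t}" "offs \<omega> i \<le> q" "q < offs \<omega> (i + 1)"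
proof -
  define i where "i = (LEAST i. q < offs \<omega> (i + 1))"
  have i: "q < offs \<omega> (i + 1)" "i \<le> t"
    unfolding i_def using assms(1) by (auto intro: LeastI Least_le)
  have "i \<noteq> 0" using i(1) offs_1 by (intro notI) simp
  then obtain i' where i': "i = Suc i'" by (cases i) auto
  then have "\<not> q < offs \<omega> (i' + 1)" using not_less_Least[of i' "\<lambda>i. q < offs \<omega> (i + 1)"]
    unfolding i_def by simp
  then show thesis using that[of i] i i' by auto
qed

lemma A_below_subdiagonal:
  assumes t: "1 \<le> t" and q: "q < n" "offs \<omega> (t + 2) \<le> q" and r: "r < offs \<omega> (t + 1)"
  shows "A $$ (q, r) = 0"
proof -
  obtain i where i: "i \<in> {1..\<mu>}" "offs \<omega> i \<le> q" "q < offs \<omega> (i + 1)"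
    using coordinate_in_block[of q \<mu>] q offs_top mu_pos by auto
  have ti: "t + 1 < i"
  proof (rule ccontr)
    assume "\<not> t + 1 < i"
    then have "offs \<omega> (i + 1) \<le> offs \<omega> (t + 2)" by (intro offs_mono) simp
    then show False using i q by simp
  qed
  obtain j where j: "j \<in> {1..t}" "offs \<omega> j \<le> r" "r < offs \<omega> (j + 1)"
    using coordinate_in_block[OF r t] .
  have "block \<omega> A i j = 0\<^sub>m (\<omega> i) (\<omega> j)"
    using form i j ti unfolding staircase_form_def by auto
  then have "block \<omega> A i j $$ (q - offs \<omega> i, r - offs \<omega> j) = 0"
    using i j offs_Suc[of i] offs_Suc[of j] by auto
  then show ?thesis
    using i j offs_Suc[of i] offs_Suc[of j] by (auto simp: block_def)
qed

definition ctrl_power :: "nat \<Rightarrow> real mat" where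
  "ctrl_power t = A ^\<^sub>m (t - 1) * B"

text \<open>
  For \<open>t \<le> \<mu>\<close> this is the lowest block row of \<open>A\<^sup>t\<^sup>-\<^sup>1 B\<close> that does not vanish: the product of the
  subdiagonal blocks in block rows \<open>t\<close> down to 2 and the top part of \<open>B\<close>.
\<close>

definition lead_block :: "nat \<Rightarrow> real mat" where
  "lead_block t = mat (\<omega> t) m (\<lambda>(r, c). ctrl_power t $$ (offs \<omega> t + r, c))"

lemma pow_carrier: "A ^\<^sub>m l \<in> carrier_mat n n"
  using A_carrier by (rule pow_carrier_mat)

lemma ctrl_power_carrier: "ctrl_power t \<in> carrier_mat n m"
  unfolding ctrl_power_def using pow_carrier B_carrier by (rule mult_carrier_mat)

lemma lead_block_carrier: "lead_block t \<in> carrier_mat (\<omega> t) m"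
  unfolding lead_block_def by simp

lemma A_pow_commute: "A * A ^\<^sub>m l = A ^\<^sub>m l * A"
proof (induction l)
  case 0
  then show ?case using A_carrier by simp
next
  case (Suc l)
  then show ?case
    using assoc_mult_mat[OF A_carrier pow_carrier A_carrier, of l] by simp
qed

lemma ctrl_power_Suc: "1 \<le> t \<Longrightarrow> ctrl_power (t + 1) = A * ctrl_power t"
  using assoc_mult_mat[OF A_carrier pow_carrier B_carrier, of "t - 1"] A_pow_commute[of "t - 1"]
  by (cases t) (auto simp: ctrl_power_def)

lemma ctrl_power_Suc_index:
  assumes "1 \<le> t" "q < n" "c < m"
  shows "ctrl_power (t + 1) $$ (q, c) = (\<Sum>r<n. A $$ (q, r) * ctrl_power t $$ (r, c))"
  unfolding ctrl_power_Suc[OF assms(1)]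
  using A_carrier ctrl_power_carrier[of t] assms
  by (auto simp: scalar_prod_def atLeast0LessThan intro!: sum.cong)

lemma ctrl_power_1: "ctrl_power 1 = B"
  using A_carrier B_carrier by (simp add: ctrl_power_def)

lemma B_split:
  obtains A10 where "A10 \<in> carrier_mat m m" "B = A10 @\<^sub>r 0\<^sub>m (n - m) m"
    "vec_space.rank m A10 = m"
  using form unfolding staircase_form_def by auto

lemma m_le_n: "m \<le> n"
  using offs_Suc[of 1] offs_1 omega_1 offs_le_n[of "1 + 1"] mu_pos by simp

text \<open>
  \<open>A\<close> has a single block subdiagonal, so each multiplication by \<open>A\<close> extends the nonzero rows by at
  most one block.
\<close>

lemma ctrl_power_below:
  assumes "1 \<le> t" "offs \<omega> (t + 1) \<le> q" "q < n" "c < m"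
  shows "ctrl_power t $$ (q, c) = 0"
  using assms
proof (induction t arbitrary: q rule: dec_induct)
  case base
  obtain A10 where A10: "A10 \<in> carrier_mat m m" "B = A10 @\<^sub>r 0\<^sub>m (n - m) m"
    by (rule B_split)
  have "m \<le> q" using base offs_Suc[of 1] offs_1 omega_1 by simp
  then have "B $$ (q, c) = 0"
    using base m_le_n
    by (subst A10(2), subst index_append_rows[OF A10(1), of _ "n - m"]) auto
  then show ?case using ctrl_power_1 by simp
next
  case (step t)
  have "A $$ (q, r) * ctrl_power t $$ (r, c) = 0" if r: "r < n" for r
    using A_below_subdiagonal[of t q r] step r by (cases "r < offs \<omega> (t + 1)") auto
  then have "(\<Sum>r<n. A $$ (q, r) * ctrl_power t $$ (r, c)) = 0"
    by (intro sum.neutral) auto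
  then show ?case
    using step.prems step.hyps ctrl_power_Suc_index[of t q c] by simp
qed

lemma lead_block_1:
  shows "lead_block 1 \<in> carrier_mat m m" and "vec_space.rank m (lead_block 1) = m"
proof -
  obtain A10 where A10: "A10 \<in> carrier_mat m m" "B = A10 @\<^sub>r 0\<^sub>m (n - m) m"
    "vec_space.rank m A10 = m"
    by (rule B_split)
  have "lead_block 1 = A10"
  proof (rule eq_matI)
    fix i j assume "i < dim_row A10" "j < dim_col A10"
    then have ij: "i < m" "j < m" using A10(1) by auto
    then have "B $$ (i, j) = A10 $$ (i, j)"
      using m_le_n by (subst A10(2), subst index_append_rows[OF A10(1), of _ "n - m"]) auto
    then show "lead_block 1 $$ (i, j) = A10 $$ (i, j)"
      unfolding lead_block_def ctrl_power_1 omega_1 offs_1 using ij by simp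
  qed (use A10(1) omega_1 in \<open>auto simp: lead_block_def\<close>)
  then show "lead_block 1 \<in> carrier_mat m m" "vec_space.rank m (lead_block 1) = m"
    using A10 by simp_all
qed

lemma sum_split_block:
  fixes f :: "nat \<Rightarrow> real"
  assumes t: "t \<in> {1..\<mu>}"
    and low: "\<And>q. q < offs \<omega> t \<Longrightarrow> f q = 0"
    and high: "\<And>q. offs \<omega> (t + 1) \<le> q \<Longrightarrow> q < n \<Longrightarrow> f q = 0"
  shows "(\<Sum>q<n. f q) = (\<Sum>r<\<omega> t. f (offs \<omega> t + r))"
proof -
  have o: "offs \<omega> (t + 1) = offs \<omega> t + \<omega> t" "offs \<omega> (t + 1) \<le> n"
    using offs_Suc[of t] offs_le_n[of "t + 1"] t by auto
  have "(\<Sum>q<n. f q) = (\<Sum>q\<in>{offs \<omega> t..<offs \<omega> t + \<omega> t}. f q)"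
    using o low high by (intro sum.mono_neutral_right) auto
  also have "\<dots> = (\<Sum>r<\<omega> t. f (offs \<omega> t + r))"
    by (rule sum.reindex_bij_witness[of _ "\<lambda>r. offs \<omega> t + r" "\<lambda>q. q - offs \<omega> t"]) auto
  finally show ?thesis .
qed

lemma lead_block_Suc:
  assumes t: "t \<in> {1..\<mu>}"
  shows "lead_block (t + 1) = block \<omega> A (t + 1) t * lead_block t"
proof (rule eq_matI)
  fix i j
  assume "i < dim_row (block \<omega> A (t + 1) t * lead_block t)"
    "j < dim_col (block \<omega> A (t + 1) t * lead_block t)"
  then have i: "i < \<omega> (t + 1)" and j: "j < m" by (auto simp: block_def lead_block_def)
  then have "t < \<mu>" using t omega_beyond by (cases "t = \<mu>") auto
  then have q: "offs \<omega> (t + 1) + i < n"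
    using offs_Suc[of "t + 1"] offs_le_n[of "t + 1 + 1"] i by simp
  \<comment> \<open>Hessenberg zeros to the left of the subdiagonal block; for \<open>t = 1\<close> there is nothing there.\<close>
  have low: "A $$ (offs \<omega> (t + 1) + i, r) = 0" if "r < offs \<omega> t" for r
  proof (cases "t = 1")
    case True
    then show ?thesis using that offs_1 by simp
  next
    case False
    then have "1 \<le> t - 1" "t - 1 + 1 = t" "t - 1 + 2 = t + 1" using t by auto
    then show ?thesis using A_below_subdiagonal[of "t - 1"] that q by simp
  qed
  have "lead_block (t + 1) $$ (i, j) =
      (\<Sum>r<n. A $$ (offs \<omega> (t + 1) + i, r) * ctrl_power t $$ (r, j))"
    using i j q t ctrl_power_Suc_index[of t] by (simp add: lead_block_def)
  also have "\<dots> = (\<Sum>r<\<omega> t. A $$ (offs \<omega> (t + 1) + i, offs \<omega> t + r)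
      * ctrl_power t $$ (offs \<omega> t + r, j))"
    using low ctrl_power_below[of t] t j by (intro sum_split_block) auto
  also have "\<dots> = (block \<omega> A (t + 1) t * lead_block t) $$ (i, j)"
    using i j by (auto simp: block_def lead_block_def scalar_prod_def atLeast0LessThan intro!: sum.cong)
  finally show "lead_block (t + 1) $$ (i, j) = (block \<omega> A (t + 1) t * lead_block t) $$ (i, j)" .
qed (auto simp: block_def lead_block_def)

lemma subdiagonal_rank:
  assumes "i \<in> {2..\<mu>}"
  shows "vec_space.rank (\<omega> i) (block \<omega> A i (i - 1)) = \<omega> i"
  using form assms unfolding staircase_form_def by blast

lemma lead_block_surj:
  assumes "t \<in> {1..\<mu>}" "v \<in> carrier_vec (\<omega> t)"
  shows "\<exists>u\<in>carrier_vec m. lead_block t *\<^sub>v u = v"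
proof -
  have "1 \<le> t" "t \<le> \<mu>" using assms(1) by auto
  then show ?thesis using assms(2)
  proof (induction t arbitrary: v rule: dec_induct)
    case base
    then show ?case using full_row_rank_surj[OF lead_block_1, of v] omega_1 by metis
  next
    case (step t)
    have "vec_space.rank (\<omega> (t + 1)) (block \<omega> A (t + 1) t) = \<omega> (t + 1)"
      using subdiagonal_rank[of "t + 1"] step.hyps step.prems by simp
    moreover have blk: "block \<omega> A (t + 1) t \<in> carrier_mat (\<omega> (t + 1)) (\<omega> t)"
      by (simp add: block_def)
    moreover have "v \<in> carrier_vec (\<omega> (t + 1))" using step.prems by simp
    ultimately obtain w where w: "w \<in> carrier_vec (\<omega> t)" "block \<omega> A (t + 1) t *\<^sub>v w = v"
      by (metis full_row_rank_surj)
    then obtain u where u: "u \<in> carrier_vec m" "lead_block t *\<^sub>v u = w"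
      using step by auto
    have "lead_block (t + 1) *\<^sub>v u = v"
      using lead_block_Suc[of t] step w u
        assoc_mult_mat_vec[OF blk lead_block_carrier u(1)] by auto
    then show ?case using u by auto
  qed
qed

lemma prod_row_index:
  assumes C: "C \<in> carrier_mat m n" and "i < m" "j < m"
  shows "(C * A ^\<^sub>m (t - 1) * B) $$ (i, j) = (\<Sum>q<n. C $$ (i, q) * ctrl_power t $$ (q, j))"
proof -
  have "C * A ^\<^sub>m (t - 1) * B = C * ctrl_power t"
    unfolding ctrl_power_def using assoc_mult_mat[OF C pow_carrier B_carrier] .
  then show ?thesis
    using assms ctrl_power_carrier[of t]
    by (auto simp: scalar_prod_def atLeast0LessThan intro!: sum.cong)
qed

lemma row_eq_0_iff:
  assumes C: "C \<in> carrier_mat m n" and i: "i < m"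
  shows "row (C * A ^\<^sub>m (t - 1) * B) i = 0\<^sub>v m \<longleftrightarrow>
    (\<forall>j<m. (C * A ^\<^sub>m (t - 1) * B) $$ (i, j) = 0)"
proof -
  have "C * A ^\<^sub>m (t - 1) * B \<in> carrier_mat m m"
    using C pow_carrier B_carrier by auto
  from carrier_matD[OF this] show ?thesis using i by (auto simp: vec_eq_iff)
qed

text \<open>
  For a row of \<open>C\<close> that vanishes on the blocks before block \<open>t\<close>, only block \<open>t\<close> meets a nonzero part
  of \<open>A\<^sup>t\<^sup>-\<^sup>1 B\<close>: the earlier blocks are killed by the row, the later ones by \<open>A\<^sup>t\<^sup>-\<^sup>1 B\<close>.
\<close>

lemma prod_row_lead:
  assumes C: "C \<in> carrier_mat m n" and i: "i < m" and j: "j < m" and t: "t \<in> {1..\<mu>}"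
    and low: "\<And>q. q < offs \<omega> t \<Longrightarrow> C $$ (i, q) = 0"
  shows "(C * A ^\<^sub>m (t - 1) * B) $$ (i, j) =
    (\<Sum>r<\<omega> t. C $$ (i, offs \<omega> t + r) * lead_block t $$ (r, j))"
  unfolding prod_row_index[OF C i j]
  using low ctrl_power_below[of t] t j
  by (subst sum_split_block[of t]) (auto simp: lead_block_def)

lemma prod_row_below_lead:
  assumes C: "C \<in> carrier_mat m n" and i: "i < m" and l: "l \<in> {1..<t}"
    and low: "\<And>q. q < offs \<omega> t \<Longrightarrow> C $$ (i, q) = 0"
  shows "row (C * A ^\<^sub>m (l - 1) * B) i = 0\<^sub>v m"
proof -
  have "C $$ (i, q) * ctrl_power l $$ (q, j) = 0" if "q < n" "j < m" for q j
    using low[of q] ctrl_power_below[of l q j] l that offs_mono[of "l + 1" t]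
    by (cases "q < offs \<omega> t") auto
  then have "(C * A ^\<^sub>m (l - 1) * B) $$ (i, j) = 0" if "j < m" for j
    unfolding prod_row_index[OF C i that] using that by (intro sum.neutral) auto
  then show ?thesis unfolding row_eq_0_iff[OF C i] by blast
qed

lemma lead_block_left_kernel:
  assumes t: "t \<in> {1..\<mu>}" and s: "\<And>j. j < m \<Longrightarrow> (\<Sum>r<\<omega> t. s r * lead_block t $$ (r, j)) = 0"
    and r: "r < \<omega> t"
  shows "s r = 0"
proof -
  obtain u where u: "u \<in> carrier_vec m" "lead_block t *\<^sub>v u = unit_vec (\<omega> t) r"
    using lead_block_surj[OF t, of "unit_vec (\<omega> t) r"] by auto
  have idx: "(\<Sum>j<m. lead_block t $$ (r', j) * u $ j) = (if r' = r then 1 else 0)"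
    if "r' < \<omega> t" for r'
    using arg_cong[OF u(2), of "\<lambda>v. v $ r'"] that r u(1) lead_block_carrier[of t]
    by (auto simp: scalar_prod_def atLeast0LessThan)
  have "s r = (\<Sum>r'<\<omega> t. s r' * (if r' = r then 1 else 0))"
    using r by (simp add: if_distrib[of "(*) _"] cong: if_cong)
  also have "\<dots> = (\<Sum>r'<\<omega> t. s r' * (\<Sum>j<m. lead_block t $$ (r', j) * u $ j))"
    using idx by (intro sum.cong) auto
  also have "\<dots> = (\<Sum>j<m. (\<Sum>r'<\<omega> t. s r' * lead_block t $$ (r', j)) * u $ j)"
    unfolding sum_distrib_left sum_distrib_right by (subst sum.swap) (simp add: mult.assoc)
  also have "\<dots> = 0" using s by simp
  finally show ?thesis .
qed

text \<open>
  The converse of \<open>prod_row_below_lead\<close>: the vanishing of the products forces the blocks of the row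
  to vanish one after the other, since each leading block has a trivial left kernel.
\<close>

lemma row_zero_prefix:
  assumes C: "C \<in> carrier_mat m n" and i: "i < m" and t: "1 \<le> t" "t \<le> \<mu> + 1"
    and zero: "\<And>l. l \<in> {1..<t} \<Longrightarrow> row (C * A ^\<^sub>m (l - 1) * B) i = 0\<^sub>v m"
    and q: "q < offs \<omega> t"
  shows "C $$ (i, q) = 0"
  using t zero q
proof (induction t arbitrary: q rule: dec_induct)
  case base
  then show ?case using offs_1 by simp
next
  case (step t)
  then have low: "C $$ (i, q) = 0" if "q < offs \<omega> t" for q using that by auto
  have t: "t \<in> {1..\<mu>}" using step by auto
  have "row (C * A ^\<^sub>m (t - 1) * B) i = 0\<^sub>v m" using step by auto
  then have "(\<Sum>r<\<omega> t. C $$ (i, offs \<omega> t + r) * lead_block t $$ (r, j)) = 0" if "j < m" for j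
    using prod_row_lead[OF C i that t low] row_eq_0_iff[OF C i, of t] that by simp
  from lead_block_left_kernel[OF t this]
  have lead: "C $$ (i, offs \<omega> t + r) = 0" if "r < \<omega> t" for r using that by blast
  show ?case
    using low[of q] lead[of "q - offs \<omega> t"] step.prems(3) offs_Suc[of t] t
    by (cases "q < offs \<omega> t") auto
qed

end

section \<open>Controllability indices of a staircase pair\<close>

context staircase_pair
begin

interpretation V: vec_space "TYPE(real)" n .

definition ctrl_col :: "nat \<Rightarrow> real vec" where
  "ctrl_col p = col (ctrl_mat n m A B) p"

lemma m_pos: "1 \<le> m"
  using omega_pos[of 1] mu_pos omega_1 by simp

lemma ctrl_col_carrier: "ctrl_col p \<in> carrier_vec n"
  by (rule carrier_vecI) (simp add: ctrl_col_def ctrl_mat_def)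

lemma ctrl_col_image_carrier: "ctrl_col ` S \<subseteq> carrier_vec n"
  using ctrl_col_carrier by auto

lemma ctrl_col_eq:
  assumes "l < n" "j < m"
  shows "ctrl_col (l * m + j) = col (ctrl_power (l + 1)) j"
proof -
  have "l * m + j < (l + 1) * m" using assms by simp
  also have "\<dots> \<le> n * m" using assms by (intro mult_right_mono) auto
  finally have lt: "l * m + j < n * m" .
  have dm: "(l * m + j) div m = l" "(l * m + j) mod m = j" using assms by auto
  show ?thesis
    using lt dm ctrl_power_carrier[of "l + 1"] A_carrier assms
    by (intro eq_vecI) (auto simp: ctrl_col_def ctrl_mat_def ctrl_power_def)
qed

lemma mult_ctrl_col:
  assumes "l + 1 < n" "j < m"
  shows "A *\<^sub>v ctrl_col (l * m + j) = ctrl_col ((l + 1) * m + j)"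
  unfolding ctrl_col_eq[OF assms] using assms ctrl_col_eq[of l j]
    ctrl_power_Suc[of "l + 1"] col_mult2[OF A_carrier ctrl_power_carrier assms(2), of "l + 1"]
  by simp

text \<open>
  The columns of \<open>B, A B, \<dots>, A\<^sup>l\<^sup>-\<^sup>1 B\<close> span all vectors supported on the first \<open>l\<close> blocks: by
  surjectivity of the leading block, the last of these blocks can be cleared with a combination of
  the columns of \<open>A\<^sup>l\<^sup>-\<^sup>1 B\<close>, which leaves a vector supported on one block less.
\<close>

lemma span_first_columns:
  assumes "l \<le> \<mu>" "v \<in> carrier_vec n" "\<And>q. offs \<omega> (l + 1) \<le> q \<Longrightarrow> q < n \<Longrightarrow> v $ q = 0"
  shows "v \<in> V.span (ctrl_col ` {..<l * m})"
  using assms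
proof (induction l arbitrary: v)
  case 0
  then have "v = 0\<^sub>v n" using offs_1 by (intro eq_vecI) auto
  then show ?case using vectorspace.span_zero[OF V.vectorspace_axioms] by simp
next
  case (Suc l)
  let ?Q = "ctrl_power (l + 1)"
  have t: "l + 1 \<in> {1..\<mu>}" and ln: "l < n" using Suc.prems(1) mu_le_n by auto
  have o: "offs \<omega> (l + 1 + 1) = offs \<omega> (l + 1) + \<omega> (l + 1)" "offs \<omega> (l + 1 + 1) \<le> n"
    using offs_Suc[of "l + 1"] offs_le_n[of "l + 1 + 1"] t by auto
  obtain u where u: "u \<in> carrier_vec m"
    "lead_block (l + 1) *\<^sub>v u = vec (\<omega> (l + 1)) (\<lambda>r. v $ (offs \<omega> (l + 1) + r))"
    using lead_block_surj[OF t, of "vec (\<omega> (l + 1)) (\<lambda>r. v $ (offs \<omega> (l + 1) + r))"] by auto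
  define w where "w = ?Q *\<^sub>v u"
  have w: "w \<in> carrier_vec n" unfolding w_def using ctrl_power_carrier[of "l + 1"] u(1) by auto
  have widx: "w $ q = (\<Sum>j<m. ?Q $$ (q, j) * u $ j)" if "q < n" for q
    unfolding w_def using that ctrl_power_carrier[of "l + 1"] u(1)
    by (auto simp: scalar_prod_def atLeast0LessThan)
  have "v - w \<in> V.span (ctrl_col ` {..<l * m})"
  proof (rule Suc.IH)
    show "l \<le> \<mu>" "v - w \<in> carrier_vec n" using Suc.prems w by auto
    fix q assume q: "offs \<omega> (l + 1) \<le> q" "q < n"
    show "(v - w) $ q = 0"
    proof (cases "offs \<omega> (l + 1 + 1) \<le> q")
      case True
      then have "w $ q = 0" unfolding widx[OF q(2)]
        using ctrl_power_below[of "l + 1" q] q by (intro sum.neutral) auto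
      then show ?thesis using Suc.prems True q w by simp
    next
      case False
      define r where "r = q - offs \<omega> (l + 1)"
      have r: "q = offs \<omega> (l + 1) + r" "r < \<omega> (l + 1)" using False q o unfolding r_def by auto
      have "w $ q = (lead_block (l + 1) *\<^sub>v u) $ r" unfolding widx[OF q(2)]
        using r u(1) lead_block_carrier[of "l + 1"]
        by (auto simp: lead_block_def scalar_prod_def atLeast0LessThan intro!: sum.cong)
      then have "w $ q = v $ q" using u(2) r by simp
      then show ?thesis using q w Suc.prems by simp
    qed
  qed
  then have vw: "v - w \<in> V.span (ctrl_col ` {..<Suc l * m})"
    by (rule subsetD[OF V.span_is_monotone, rotated]) auto
  have "w \<in> V.col_space ?Q"
    unfolding V.col_space_eq[OF ctrl_power_carrier] w_def
    using u(1) ctrl_power_carrier[of "l + 1"] by auto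
  moreover have "set (cols ?Q) \<subseteq> ctrl_col ` {..<Suc l * m}"
  proof
    fix x assume "x \<in> set (cols ?Q)"
    then obtain j where j: "j < m" "x = col ?Q j"
      using ctrl_power_carrier[of "l + 1"] by (auto simp: cols_def)
    then show "x \<in> ctrl_col ` {..<Suc l * m}" using ctrl_col_eq[OF ln j(1)]
      by (intro image_eqI[of _ _ "l * m + j"]) auto
  qed
  ultimately have "w \<in> V.span (ctrl_col ` {..<Suc l * m})"
    unfolding V.col_space_def using V.span_is_monotone by blast
  from V.span_add1[OF ctrl_col_image_carrier vw this]
  have "(v - w) + w \<in> V.span (ctrl_col ` {..<Suc l * m})" by simp
  moreover have "(v - w) + w = v" using w Suc.prems by auto
  ultimately show ?case by simp
qed

lemma ctrl_col_below:
  assumes p: "p < l * m" and l: "l \<le> \<mu>" and q: "offs \<omega> (l + 1) \<le> q" "q < n"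
  shows "ctrl_col p $ q = 0"
proof -
  have pm: "p mod m < m" "p div m < l" using p m_pos by (auto simp: less_mult_imp_div_less)
  then have "ctrl_col p = col (ctrl_power (p div m + 1)) (p mod m)"
    using ctrl_col_eq[of "p div m" "p mod m"] l mu_le_n by simp
  moreover have "offs \<omega> (p div m + 1 + 1) \<le> q"
    using offs_mono[of "p div m + 1 + 1" "l + 1"] pm q by simp
  ultimately show ?thesis
    using ctrl_power_below[of "p div m + 1" q "p mod m"] ctrl_power_carrier[of "p div m + 1"] pm q
    by simp
qed

lemma selected_cols_eq:
  "selected_cols n m A B = {p. p < n * m \<and> ctrl_col p \<notin> V.span (ctrl_col ` {..<p})}"
  unfolding selected_cols_def ctrl_col_def by (simp add: image_image)

text \<open>
  The columns before \<open>l * m\<close> span the vectors supported on the first \<open>offs \<omega> (l + 1)\<close> coordinates.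
  To count the selected ones without speaking about the dimension of a subspace, the
  remaining unit vectors are put behind them. Each of these is a pivot, and there are \<open>n\<close> pivots
  altogether.
\<close>

lemma card_selected_before:
  assumes l: "l \<le> \<mu>"
  shows "card {p \<in> selected_cols n m A B. p < l * m} = offs \<omega> (l + 1)"
proof -
  let ?s = "offs \<omega> (l + 1)" and ?L = "l * m"
  have sn: "?s \<le> n" using offs_le_n[of "l + 1"] l by simp
  define f where "f p = (if p < ?L then ctrl_col p else unit_vec n (?s + (p - ?L)))" for p
  define N where "N = ?L + (n - ?s)"
  have fcar: "f p \<in> carrier_vec n" for p
    unfolding f_def using ctrl_col_carrier by auto
  have fim: "f ` S \<subseteq> carrier_vec n" for S using fcar by auto
  have f_low: "f ` {..<p} = ctrl_col ` {..<p}" if "p \<le> ?L" for p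
    unfolding f_def using that by (intro image_cong) auto
  have sp: "V.span (f ` {..<N}) = carrier_vec n"
  proof
    show "V.span (f ` {..<N}) \<subseteq> carrier_vec n" using V.span_is_subset2[OF fim] by simp
    have "set (unit_vecs n) \<subseteq> V.span (f ` {..<N})"
    proof
      fix x :: "real vec" assume "x \<in> set (unit_vecs n)"
      then obtain i where i: "i < n" "x = unit_vec n i" by (auto simp: unit_vecs_def)
      show "x \<in> V.span (f ` {..<N})"
      proof (cases "i < ?s")
        case True
        then have "x \<in> V.span (ctrl_col ` {..<?L})"
          using i by (intro span_first_columns[OF l]) auto
        also have "\<dots> \<subseteq> V.span (f ` {..<N})"
          unfolding f_low[OF order_refl, symmetric] N_def
          by (rule V.span_is_monotone) auto
        finally show ?thesis .
      next
        case False
        then have "x = f (?L + (i - ?s))" "?L + (i - ?s) < N"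
          using i sn by (auto simp: f_def N_def)
        then show ?thesis using V.span_mem[of "f ` {..<N}" x] fim by auto
      qed
    qed
    then have "V.span (set (unit_vecs n)) \<subseteq> V.span (f ` {..<N})"
      by (rule V.span_subsetI[OF fim])
    then show "carrier_vec n \<subseteq> V.span (f ` {..<N})" by (simp add: V.span_unit_vecs_is_carrier)
  qed
  \<comment> \<open>The vectors before \<open>f p\<close> all vanish at the coordinate where this unit vector is 1.\<close>
  have new: "f p \<notin> V.span (f ` {..<p})" if p: "?L \<le> p" "p < N" for p
  proof
    define i where "i = ?s + (p - ?L)"
    have i: "i < n" "?s \<le> i" using p sn by (auto simp: i_def N_def)
    assume "f p \<in> V.span (f ` {..<p})"
    then have "f p $ i = 0"
    proof (rule V.span_induct[OF fim])
      fix x assume "x \<in> f ` {..<p}"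
      then obtain p' where p': "p' < p" "x = f p'" by auto
      show "x $ i = 0"
      proof (cases "p' < ?L")
        case True
        then show ?thesis using ctrl_col_below[OF True l i(2,1)] p' by (simp add: f_def)
      next
        case False
        then show ?thesis using p' p i by (auto simp: f_def i_def)
      qed
    qed (use i in auto)
    then show False using p i by (auto simp: f_def i_def)
  qed
  have "card {p. p < N \<and> f p \<notin> V.span (f ` {..<p})} = n"
    by (rule V.card_pivots[OF fcar sp])
  also have "{p. p < N \<and> f p \<notin> V.span (f ` {..<p})} =
      {p \<in> selected_cols n m A B. p < ?L} \<union> {?L..<N}"
  proof -
    have "?L \<le> n * m" using l mu_le_n by (intro mult_right_mono) auto
    then have "p \<in> selected_cols n m A B \<longleftrightarrow> f p \<notin> V.span (f ` {..<p})" if "p < ?L" for p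
      using f_low[of p] that less_le_trans[OF that, of "n * m"]
      by (simp add: selected_cols_eq f_def)
    then show ?thesis using new by (auto simp: N_def not_less simp del: One_nat_def)
  qed
  also have "card \<dots> = card {p \<in> selected_cols n m A B. p < ?L} + (n - ?s)"
    by (subst card_Un_disjoint) (auto simp: N_def)
  finally show ?thesis using sn by simp
qed

lemma not_selected_after:
  assumes "\<mu> * m \<le> p"
  shows "p \<notin> selected_cols n m A B"
proof -
  have "ctrl_col p \<in> V.span (ctrl_col ` {..<\<mu> * m})"
    using ctrl_col_carrier offs_top by (intro span_first_columns) auto
  also have "\<dots> \<subseteq> V.span (ctrl_col ` {..<p})"
    using assms by (intro V.span_is_monotone) auto
  finally show ?thesis unfolding selected_cols_eq by simp
qed

definition selected_inputs :: "nat \<Rightarrow> nat set" where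
  "selected_inputs l = {j. j < m \<and> l * m + j \<in> selected_cols n m A B}"

lemma card_selected_inputs: "card (selected_inputs l) = (if l < \<mu> then \<omega> (l + 1) else 0)"
proof (cases "l < \<mu>")
  case True
  let ?S = "selected_cols n m A B"
  have "{p \<in> ?S. p < (l + 1) * m} = {p \<in> ?S. p < l * m} \<union> (\<lambda>j. l * m + j) ` selected_inputs l"
    (is "?X = ?Y \<union> ?Z")
  proof (rule Set.set_eqI, rule iffI)
    fix p assume p: "p \<in> ?X"
    show "p \<in> ?Y \<union> ?Z"
    proof (cases "p < l * m")
      case False
      then have "p = l * m + (p - l * m)" "p - l * m \<in> selected_inputs l"
        using p by (auto simp: selected_inputs_def)
      then show ?thesis by blast
    qed (use p in auto)
  qed (auto simp: selected_inputs_def)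
  moreover have "card (?Y \<union> ?Z) = card ?Y + card ?Z"
    by (rule card_Un_disjoint) (auto simp: selected_inputs_def)
  moreover have "card ?Z = card (selected_inputs l)"
    by (rule card_image) (auto simp: inj_on_def)
  ultimately have "offs \<omega> (l + 1 + 1) = offs \<omega> (l + 1) + card (selected_inputs l)"
    using card_selected_before[of l] card_selected_before[of "l + 1"] True by simp
  then show ?thesis using offs_Suc[of "l + 1"] True by simp
next
  case False
  then have "\<mu> * m \<le> l * m" by (intro mult_right_mono) auto
  from not_selected_after[OF trans_le_add1[OF this]] have "selected_inputs l = {}"
    unfolding selected_inputs_def by blast
  then show ?thesis using False by simp
qed

text \<open>
  If \<open>A\<^sup>l b\<^sub>j\<close> depends on earlier columns, apply \<open>A\<close>: since \<open>A\<close> moves every column \<open>m\<close> places to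
  the right, \<open>A\<^sup>l\<^sup>+\<^sup>1 b\<^sub>j\<close> depends on earlier columns as well. Hence the powers selected for one input
  form an initial segment.
\<close>

lemma selected_shift:
  assumes "(l + 1) * m + j \<in> selected_cols n m A B" "j < m"
  shows "l * m + j \<in> selected_cols n m A B"
proof (rule ccontr)
  assume nsel: "l * m + j \<notin> selected_cols n m A B"
  have lt: "(l + 1) * m + j < n * m" using assms(1) by (simp add: selected_cols_eq)
  have ln: "l + 1 < n"
  proof (rule ccontr)
    assume "\<not> l + 1 < n"
    then have "n * m \<le> (l + 1) * m" by (intro mult_right_mono) auto
    then show False using lt by simp
  qed
  have "ctrl_col (l * m + j) \<in> V.span (ctrl_col ` {..<l * m + j})"
    using nsel lt by (simp add: selected_cols_eq)
  then have "A *\<^sub>v ctrl_col (l * m + j) \<in> V.span (ctrl_col ` {..<(l + 1) * m + j})"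
  proof (rule V.mult_mat_vec_span[OF A_carrier ctrl_col_image_carrier _ ctrl_col_image_carrier])
    fix x assume "x \<in> ctrl_col ` {..<l * m + j}"
    then obtain p where p: "p < l * m + j" "x = ctrl_col p" by auto
    have "p div m < l + 1"
      using p(1) assms(2) by (intro less_mult_imp_div_less) simp
    then have "A *\<^sub>v x = ctrl_col (p + m)"
      using mult_ctrl_col[of "p div m" "p mod m"] p ln m_pos by (simp add: algebra_simps)
    moreover have "p + m < (l + 1) * m + j" using p by simp
    ultimately show "A *\<^sub>v x \<in> V.span (ctrl_col ` {..<(l + 1) * m + j})"
      using V.span_mem[OF ctrl_col_image_carrier] by auto
  qed
  then have "ctrl_col ((l + 1) * m + j) \<in> V.span (ctrl_col ` {..<(l + 1) * m + j})"
    using mult_ctrl_col[OF ln assms(2)] by simp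
  then show False using assms(1) by (simp add: selected_cols_eq)
qed

lemma column_count_iff:
  assumes j: "j < m"
  shows "l < card {p \<in> selected_cols n m A B. p mod m = j} \<longleftrightarrow> j \<in> selected_inputs l"
proof -
  let ?S = "{l. j \<in> selected_inputs l}"
  have "?S \<subseteq> {..<\<mu>}"
  proof
    fix l assume "l \<in> ?S"
    then have "card (selected_inputs l) \<noteq> 0" by (auto simp: selected_inputs_def)
    then show "l \<in> {..<\<mu>}" using card_selected_inputs[of l] by (auto split: if_splits)
  qed
  then have "finite ?S" using finite_subset by blast
  then have S: "?S = {..<card ?S}"
    using selected_shift[of _ j] j
    by (intro downward_closed_eq_lessThan) (auto simp: selected_inputs_def)
  have img: "{p \<in> selected_cols n m A B. p mod m = j} = (\<lambda>l. l * m + j) ` ?S"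
  proof (rule Set.set_eqI, rule iffI)
    fix p assume p: "p \<in> {p \<in> selected_cols n m A B. p mod m = j}"
    then have "p = p div m * m + j" by auto
    moreover from this have "p div m \<in> ?S" using p j by (auto simp: selected_inputs_def)
    ultimately show "p \<in> (\<lambda>l. l * m + j) ` ?S" by blast
  qed (use j in \<open>auto simp: selected_inputs_def\<close>)
  have "inj_on (\<lambda>l. l * m + j) ?S" using m_pos by (intro inj_onI) simp
  then have "card {p \<in> selected_cols n m A B. p mod m = j} = card ?S"
    unfolding img by (rule card_image)
  moreover have "l < card ?S \<longleftrightarrow> l \<in> ?S" by (subst (2) S) simp
  ultimately show ?thesis by simp
qed

text \<open>
  The number of inputs selected at power \<open>l < \<mu>\<close> is \<open>\<omega> (l + 1)\<close>, and the number of powers selected for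
  an input is one of the controllability indices. So these are conjugate to the block sizes:
  with rows numbered from 0, the index of row \<open>i\<close> is the last \<open>t \<le> \<mu>\<close> with \<open>i < \<omega> t\<close>.
\<close>

lemma controllability_index_eq:
  assumes t: "t \<in> {1..\<mu>}" and i: "\<omega> (t + 1) \<le> i" "i < \<omega> t"
  shows "controllability_indices n m A B ! i = t"
proof -
  let ?xs = "map (\<lambda>j. card {p \<in> selected_cols n m A B. p mod m = j}) [0..<m]"
  have "i < m" using omega_antimono[of 1 t] t i omega_1 by simp
  have "controllability_indices n m A B ! i = card {l. i < card {j. j < m \<and> l < ?xs ! j}}"
    unfolding controllability_indices_def using sorted_conjugate[of i ?xs] \<open>i < m\<close> by simp
  also have "\<dots> = card {l. i < card (selected_inputs l)}"
  proof -
    have "{j. j < m \<and> l < ?xs ! j} = selected_inputs l" for l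
      using column_count_iff[of _ l] by (auto simp: selected_inputs_def)
    then show ?thesis by simp
  qed
  also have "{l. i < card (selected_inputs l)} = {..<t}"
  proof (rule Set.set_eqI, rule iffI)
    fix l assume "l \<in> {l. i < card (selected_inputs l)}"
    then have l: "l < \<mu>" "i < \<omega> (l + 1)" by (auto simp: card_selected_inputs split: if_splits)
    show "l \<in> {..<t}"
    proof (rule ccontr)
      assume "l \<notin> {..<t}"
      then have "\<omega> (l + 1) \<le> \<omega> (t + 1)" using l t by (intro omega_antimono) auto
      then show False using l i by simp
    qed
  next
    fix l assume "l \<in> {..<t}"
    then have "\<omega> t \<le> \<omega> (l + 1)" "l < \<mu>" using t by (auto intro: omega_antimono)
    then show "l \<in> {l. i < card (selected_inputs l)}" using i by (simp add: card_selected_inputs)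
  qed
  finally show ?thesis by simp
qed

lemma row_level_exists:
  assumes "i < m"
  obtains t where "t \<in> {1..\<mu>}" "\<omega> (t + 1) \<le> i" "i < \<omega> t"
proof -
  define t where "t = (LEAST t. \<omega> (t + 1) \<le> i)"
  have t: "\<omega> (t + 1) \<le> i" "t \<le> \<mu>"
    unfolding t_def using omega_beyond LeastI[of "\<lambda>t. \<omega> (t + 1) \<le> i" \<mu>]
    by (auto intro: Least_le)
  have "t \<noteq> 0" using t(1) assms omega_1 by (intro notI) simp
  then obtain t' where t': "t = Suc t'" by (cases t) auto
  then have "\<not> \<omega> (t' + 1) \<le> i" using not_less_Least[of t' "\<lambda>t. \<omega> (t + 1) \<le> i"]
    unfolding t_def by simp
  then show thesis using that[of t] t t' by auto
qed

end

section \<open>Decoupling in terms of bordered blocks\<close>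

context staircase_pair
begin

text \<open>
  The rows \<open>i\<close> with \<open>\<omega> (t + 1) \<le> i < \<omega> t\<close> are those with controllability index \<open>t\<close>. Working with
  all levels \<open>t\<close>, also those without rows, avoids reference to the enumeration \<open>k\<close>. At level
  \<open>\<mu>\<close> the upper part of \<open>bordered_block\<close> has no rows, so that the first condition on the
  parameters is an instance of the others.
\<close>

definition prefix_zero :: "real mat \<Rightarrow> bool" where
  "prefix_zero C \<longleftrightarrow> (\<forall>t\<in>{1..\<mu>}. \<forall>i\<in>{\<omega> (t + 1)..<\<omega> t}. \<forall>q<offs \<omega> t. C $$ (i, q) = 0)"

definition lead_part :: "real mat \<Rightarrow> nat \<Rightarrow> real mat" where
  "lead_part C t = mat (\<omega> t - \<omega> (t + 1)) (\<omega> t) (\<lambda>(r, c). C $$ (\<omega> (t + 1) + r, offs \<omega> t + c))"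

definition bordered_block :: "real mat \<Rightarrow> nat \<Rightarrow> real mat" where
  "bordered_block C t = block \<omega> A (t + 1) t @\<^sub>r lead_part C t"

lemma block_carrier: "block \<omega> A i j \<in> carrier_mat (\<omega> i) (\<omega> j)"
  by (simp add: block_def)

lemma lead_part_carrier: "lead_part C t \<in> carrier_mat (\<omega> t - \<omega> (t + 1)) (\<omega> t)"
  by (simp add: lead_part_def)

lemma bordered_block_carrier:
  assumes "t \<in> {1..\<mu>}"
  shows "bordered_block C t \<in> carrier_mat (\<omega> t) (\<omega> t)"
  using carrier_append_rows[OF block_carrier lead_part_carrier, of "t + 1" t C]
    omega_antimono[of t "t + 1"] assms unfolding bordered_block_def by auto

lemma omega_le_m: "t \<in> {1..\<mu> + 1} \<Longrightarrow> \<omega> t \<le> m"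
  using omega_antimono[of 1 t] omega_1 by simp

text \<open>
  If the decoupling indices equal the controllability indices, these are the first \<open>\<omega> t\<close> rows of the
  decoupling matrix, and all of it for \<open>t = 1\<close>.
\<close>

definition lead_rows :: "real mat \<Rightarrow> nat \<Rightarrow> real mat" where
  "lead_rows C t = mat (\<omega> t) m
     (\<lambda>(i, j). (C * A ^\<^sub>m (controllability_indices n m A B ! i - 1) * B) $$ (i, j))"

lemma lead_rows_step:
  assumes C: "C \<in> carrier_mat m n" and z: "prefix_zero C" and t: "t \<in> {1..\<mu>}"
  shows "lead_rows C t = lead_rows C (t + 1) @\<^sub>r lead_part C t * lead_block t"
proof (rule eq_matI)
  have R: "lead_rows C (t + 1) \<in> carrier_mat (\<omega> (t + 1)) m" by (simp add: lead_rows_def)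
  have S: "lead_part C t * lead_block t \<in> carrier_mat (\<omega> t - \<omega> (t + 1)) m"
    using lead_part_carrier lead_block_carrier by (rule mult_carrier_mat)
  have le: "\<omega> (t + 1) \<le> \<omega> t" using t omega_antimono[of t "t + 1"] by simp
  note RS = carrier_append_rows[OF R S]
  show "dim_row (lead_rows C t) = dim_row (lead_rows C (t + 1) @\<^sub>r lead_part C t * lead_block t)"
    "dim_col (lead_rows C t) = dim_col (lead_rows C (t + 1) @\<^sub>r lead_part C t * lead_block t)"
    using carrier_matD[OF RS] le by (auto simp: lead_rows_def)
  fix i j
  assume "i < dim_row (lead_rows C (t + 1) @\<^sub>r lead_part C t * lead_block t)"
    "j < dim_col (lead_rows C (t + 1) @\<^sub>r lead_part C t * lead_block t)"
  then have i: "i < \<omega> t" and j: "j < m" using carrier_matD[OF RS] le by auto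
  show "lead_rows C t $$ (i, j) = (lead_rows C (t + 1) @\<^sub>r lead_part C t * lead_block t) $$ (i, j)"
  proof (cases "i < \<omega> (t + 1)")
    case True
    then show ?thesis using i j le
      by (subst index_append_rows[OF R S]) (auto simp: lead_rows_def)
  next
    case False
    have im: "i < m" using i omega_le_m[of t] t by simp
    have "lead_rows C t $$ (i, j) = (C * A ^\<^sub>m (t - 1) * B) $$ (i, j)"
      using i j False controllability_index_eq[OF t, of i] by (simp add: lead_rows_def)
    also have "\<dots> = (\<Sum>r<\<omega> t. C $$ (i, offs \<omega> t + r) * lead_block t $$ (r, j))"
      using z t i False by (intro prod_row_lead[OF C im j t]) (auto simp: prefix_zero_def)
    also have "\<dots> = (lead_part C t * lead_block t) $$ (i - \<omega> (t + 1), j)"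
      using i j False carrier_matD[OF lead_block_carrier[of t]]
      by (auto simp: lead_part_def scalar_prod_def atLeast0LessThan intro!: sum.cong)
    finally show ?thesis using i j le False
      by (subst index_append_rows[OF R S]) auto
  qed
qed

text \<open>
  Descending induction on \<open>t\<close>. If the rows of the levels above \<open>t\<close> are \<open>T\<close> times \<open>lead_block (t + 1)\<close>,
  they are \<open>T\<close> times the subdiagonal block times \<open>lead_block t\<close>. The rows of level \<open>t\<close>
  add \<open>lead_part C t\<close> below the first two factors, so the new square factor is the bordered block
  multiplied by the block diagonal matrix with blocks \<open>T\<close> and \<open>1\<close>. The induction starts above level
  \<open>\<mu>\<close>, with empty matrices.
\<close>

lemma lead_rows_factor:
  assumes C: "C \<in> carrier_mat m n" and z: "prefix_zero C" and t: "1 \<le> t" "t \<le> \<mu> + 1"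
  shows "\<exists>T \<in> carrier_mat (\<omega> t) (\<omega> t). lead_rows C t = T * lead_block t \<and>
    (det T \<noteq> 0 \<longleftrightarrow> (\<forall>u\<in>{t..\<mu>}. det (bordered_block C u) \<noteq> 0))"
  using t(2,1)
proof (induction t rule: inc_induct)
  case base
  have "lead_rows C (\<mu> + 1) = 1\<^sub>m 0 * lead_block (\<mu> + 1)"
    using omega_beyond by (intro eq_matI) (auto simp: lead_rows_def lead_block_def)
  then show ?case using omega_beyond by (intro bexI[of _ "1\<^sub>m 0"]) auto
next
  case (step t)
  then have t: "t \<in> {1..\<mu>}" by auto
  have le: "\<omega> (t + 1) \<le> \<omega> t" using t omega_antimono[of t "t + 1"] by simp
  obtain T where T: "T \<in> carrier_mat (\<omega> (t + 1)) (\<omega> (t + 1))"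
    "lead_rows C (t + 1) = T * lead_block (t + 1)"
    "det T \<noteq> 0 \<longleftrightarrow> (\<forall>u\<in>{t + 1..\<mu>}. det (bordered_block C u) \<noteq> 0)"
    using step by auto
  let ?X = "block \<omega> A (t + 1) t" and ?S = "lead_part C t"
  let ?T = "T * ?X @\<^sub>r ?S"
  have TX: "T * ?X \<in> carrier_mat (\<omega> (t + 1)) (\<omega> t)"
    using T(1) block_carrier by (rule mult_carrier_mat)
  have "lead_rows C t = T * (?X * lead_block t) @\<^sub>r ?S * lead_block t"
    unfolding lead_rows_step[OF C z t] T(2) lead_block_Suc[OF t] ..
  also have "\<dots> = ?T * lead_block t"
    unfolding append_rows_mult[OF TX lead_part_carrier lead_block_carrier]
      assoc_mult_mat[OF T(1) block_carrier lead_block_carrier] ..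
  finally have eq: "lead_rows C t = ?T * lead_block t" .
  have w: "\<omega> t = \<omega> (t + 1) + (\<omega> t - \<omega> (t + 1))" using le by simp
  have "det ?T = det T * det (bordered_block C t)"
    unfolding bordered_block_def
    using det_mult_append_rows[of T "\<omega> (t + 1)" ?X "\<omega> t - \<omega> (t + 1)" ?S]
      T(1) block_carrier[of "t + 1" t] lead_part_carrier[of C t] w by simp
  moreover have "{t..\<mu>} = insert t {t + 1..\<mu>}" using t by auto
  ultimately have "det ?T \<noteq> 0 \<longleftrightarrow> (\<forall>u\<in>{t..\<mu>}. det (bordered_block C u) \<noteq> 0)"
    using T(3) by auto
  moreover have "?T \<in> carrier_mat (\<omega> t) (\<omega> t)"
    using carrier_append_rows[OF TX lead_part_carrier, of C] w by simp
  ultimately show ?case using eq by blast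
qed

lemma det_lead_rows_iff:
  assumes C: "C \<in> carrier_mat m n" and z: "prefix_zero C"
  shows "det (lead_rows C 1) \<noteq> 0 \<longleftrightarrow> (\<forall>t\<in>{1..\<mu>}. det (bordered_block C t) \<noteq> 0)"
proof -
  obtain T where T: "T \<in> carrier_mat m m" "lead_rows C 1 = T * lead_block 1"
    "det T \<noteq> 0 \<longleftrightarrow> (\<forall>u\<in>{1..\<mu>}. det (bordered_block C u) \<noteq> 0)"
    using lead_rows_factor[OF C z, of 1] omega_1 by auto
  have "det (lead_block 1) \<noteq> 0"
    using vec_space.det_rank_iff[OF lead_block_1(1)] lead_block_1(2) by blast
  then show ?thesis using T det_mult[OF T(1) lead_block_1(1)] by simp
qed

lemma decoupling_index_candidates:
  assumes "decoupling_candidates n m A B C i \<noteq> {}"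
  shows "decoupling_index n m A B C i = t \<longleftrightarrow>
    t \<in> decoupling_candidates n m A B C i \<and>
    (\<forall>l\<in>{1..<t}. l \<notin> decoupling_candidates n m A B C i)"
proof -
  let ?K = "decoupling_candidates n m A B C i"
  have fin: "finite ?K" by (simp add: decoupling_candidates_def)
  have pos: "l \<in> ?K \<Longrightarrow> 1 \<le> l" for l by (simp add: decoupling_candidates_def)
  show ?thesis
    unfolding decoupling_index_def Min_eq_iff[OF fin assms]
    using pos by (metis atLeastLessThan_iff leD leI)
qed

text \<open>
  A decoupling index of at least \<open>t\<close> means that the row vanishes on the blocks before \<open>t\<close>. Once the
  indices agree, the decoupling matrix is \<open>lead_rows C 1\<close>. In the backward direction the index is
  attained because a nonsingular matrix has no zero row.
\<close>

lemma decoupled_iff: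
  assumes C: "C \<in> carrier_mat m n"
  shows "decouplable n m A B C \<and>
      (\<forall>i<m. decoupling_index n m A B C i = controllability_indices n m A B ! i) \<longleftrightarrow>
    prefix_zero C \<and> (\<forall>t\<in>{1..\<mu>}. det (bordered_block C t) \<noteq> 0)" (is "?L \<longleftrightarrow> ?R")
proof -
  let ?ci = "\<lambda>i. controllability_indices n m A B ! i"
  let ?K = "decoupling_candidates n m A B C"
  have D: "decoupling_mat n m A B C = lead_rows C 1"
    if "\<forall>i<m. decoupling_index n m A B C i = ?ci i"
  proof (rule eq_matI)
    fix i j assume "i < dim_row (lead_rows C 1)" "j < dim_col (lead_rows C 1)"
    then have ij: "i < m" "j < m" using omega_1 by (auto simp: lead_rows_def)
    have car: "C * A ^\<^sub>m (?ci i - 1) * B \<in> carrier_mat m m"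
      using C pow_carrier B_carrier by auto
    show "decoupling_mat n m A B C $$ (i, j) = lead_rows C 1 $$ (i, j)"
      using that ij carrier_matD[OF car] omega_1
      by (simp add: decoupling_mat_def lead_rows_def)
  qed (use omega_1 in \<open>auto simp: decoupling_mat_def lead_rows_def\<close>)
  have inv: "invertible_mat (lead_rows C 1) \<longleftrightarrow> det (lead_rows C 1) \<noteq> 0"
    using omega_1 by (intro invertible_mat_iff_det[of _ m]) (simp add: lead_rows_def)
  show ?thesis
  proof
    assume L: ?L
    have z: "prefix_zero C"
      unfolding prefix_zero_def
    proof (intro ballI allI impI)
      fix t i q assume t: "t \<in> {1..\<mu>}" and i: "i \<in> {\<omega> (t + 1)..<\<omega> t}" and q: "q < offs \<omega> t"
      have im: "i < m" using i omega_le_m[of t] t by simp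
      have "decoupling_index n m A B C i = t" "?K i \<noteq> {}"
        using L im controllability_index_eq[OF t, of i] i by (auto simp: decouplable_def)
      then have "\<forall>l\<in>{1..<t}. l \<notin> ?K i" using decoupling_index_candidates by blast
      then have "row (C * A ^\<^sub>m (l - 1) * B) i = 0\<^sub>v m" if "l \<in> {1..<t}" for l
        using that t mu_le_n by (auto simp: decoupling_candidates_def)
      then show "C $$ (i, q) = 0" using t q by (intro row_zero_prefix[OF C im, of t]) auto
    qed
    moreover have "det (lead_rows C 1) \<noteq> 0"
      using L D inv by (simp add: decouplable_def)
    ultimately show ?R using det_lead_rows_iff[OF C] by blast
  next
    assume R: ?R
    then have z: "prefix_zero C" and det: "det (lead_rows C 1) \<noteq> 0"
      using det_lead_rows_iff[OF C] by auto
    have idx: "?K i \<noteq> {} \<and> decoupling_index n m A B C i = ?ci i" if i: "i < m" for i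
    proof -
      obtain t where t: "t \<in> {1..\<mu>}" "\<omega> (t + 1) \<le> i" "i < \<omega> t" using row_level_exists[OF i] .
      have ci: "?ci i = t" by (rule controllability_index_eq[OF t])
      have low: "C $$ (i, q) = 0" if "q < offs \<omega> t" for q
        using z t that unfolding prefix_zero_def by auto
      have below: "l \<notin> ?K i" if "l \<in> {1..<t}" for l
        using prod_row_below_lead[OF C i that low] by (simp add: decoupling_candidates_def)
      have "row (C * A ^\<^sub>m (t - 1) * B) i \<noteq> 0\<^sub>v m"
      proof
        assume "row (C * A ^\<^sub>m (t - 1) * B) i = 0\<^sub>v m"
        then have "row (lead_rows C 1) i = 0\<^sub>v m"
          unfolding row_eq_0_iff[OF C i] using ci i omega_1
          by (intro eq_vecI) (auto simp: lead_rows_def)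
        moreover have "lead_rows C 1 \<in> carrier_mat m m" using omega_1 by (simp add: lead_rows_def)
        ultimately have "det (lead_rows C 1) = 0" using i by (intro det_eq_0_if_row_eq_0)
        then show False using det by simp
      qed
      then have "t \<in> ?K i" using t mu_le_n by (simp add: decoupling_candidates_def)
      moreover from this have "?K i \<noteq> {}" by blast
      ultimately show ?thesis using decoupling_index_candidates[of C i t] below ci by simp
    qed
    then show ?L using D inv det by (simp add: decouplable_def)
  qed
qed

text \<open>
  Where the block size does not drop, the subdiagonal block is square of full rank and nothing is
  appended to it. This is why the levels without rows impose no condition.
\<close>

lemma det_bordered_block_flat:
  assumes t: "t \<in> {1..\<mu>}" and eq: "\<omega> (t + 1) = \<omega> t"
  shows "det (bordered_block C t) \<noteq> 0"
proof -
  have "t \<noteq> \<mu>" using eq omega_beyond omega_pos[OF t] by auto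
  then have rk: "vec_space.rank (\<omega> t) (block \<omega> A (t + 1) t) = \<omega> t"
    using subdiagonal_rank[of "t + 1"] t eq by simp
  have "bordered_block C t = block \<omega> A (t + 1) t"
  proof (rule eq_matI)
    fix i j assume "i < dim_row (block \<omega> A (t + 1) t)" "j < dim_col (block \<omega> A (t + 1) t)"
    then show "bordered_block C t $$ (i, j) = block \<omega> A (t + 1) t $$ (i, j)"
      unfolding bordered_block_def
      by (subst index_append_rows[OF block_carrier lead_part_carrier]) (auto simp: block_def)
  qed (use bordered_block_carrier[OF t, of C] block_carrier[of "t + 1" t] eq in auto)
  moreover have "block \<omega> A (t + 1) t \<in> carrier_mat (\<omega> t) (\<omega> t)"
    using block_carrier[of "t + 1" t] eq by simp
  ultimately show ?thesis using vec_space.det_rank_iff rk by metis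
qed

end

section \<open>The parametrization\<close>

text \<open>
  The indices \<open>k 1 > \<dots> > k g\<close> enumerate the levels that own rows of \<open>C\<close>.
\<close>

locale staircase_levels = staircase_pair +
  fixes g :: nat and k \<epsilon> :: "nat \<Rightarrow> nat"
  assumes eps_eq: "\<And>i. i \<in> {1..\<mu>} \<Longrightarrow> \<epsilon> i = \<omega> i - \<omega> (i + 1)"
    and k_step: "\<And>j. j \<in> {1..<g} \<Longrightarrow> k (j + 1) < k j"
    and k_image: "k ` {1..g} = {i \<in> {1..\<mu>}. 0 < \<epsilon> i}"
begin

lemma k_range: "j \<in> {1..g} \<Longrightarrow> k j \<in> {1..\<mu>}"
  using k_image by blast

lemma k_hits:
  assumes "t \<in> {1..\<mu>}" "\<omega> (t + 1) < \<omega> t"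
  obtains j where "j \<in> {1..g}" "k j = t"
proof -
  have "t \<in> k ` {1..g}" unfolding k_image using assms eps_eq by simp
  then show thesis using that by blast
qed

lemma k_antimono:
  assumes "i \<in> {1..g}" "j \<in> {1..g}" "i < j"
  shows "k j < k i"
proof -
  have "Suc i \<le> j" "j \<le> g" using assms by auto
  then show ?thesis
  proof (induction j rule: dec_induct)
    case base
    then show ?case using k_step[of i] assms(1) by simp
  next
    case (step j)
    then show ?case using k_step[of j] assms(1) by simp
  qed
qed

lemma k_less_iff:
  assumes "i \<in> {1..g}" "j \<in> {1..g}"
  shows "k j < k i \<longleftrightarrow> i < j"
  using k_antimono[OF assms] k_antimono[OF assms(2,1)] by (cases i j rule: linorder_cases) auto

lemma g_pos: "1 \<le> g" and k_1: "k 1 = \<mu>"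
proof -
  obtain j where j: "j \<in> {1..g}" "k j = \<mu>"
    using k_hits[of \<mu>] mu_pos omega_beyond omega_pos[of \<mu>] by auto
  then show g: "1 \<le> g" by simp
  show "k 1 = \<mu>"
  proof (cases "j = 1")
    case False
    then have "\<mu> < k 1" using k_antimono[of 1 j] j by simp
    then show ?thesis using k_range[of 1] g by simp
  qed (use j in simp)
qed

lemma sum_eps:
  assumes "1 \<le> s" "s \<le> \<mu> + 1"
  shows "(\<Sum>t\<in>{s..\<mu>}. \<epsilon> t) = \<omega> s"
  using assms(2,1)
proof (induction s rule: inc_induct)
  case base
  then show ?case using omega_beyond by simp
next
  case (step s)
  then show ?case
    using omega_antimono[of s "s + 1"] eps_eq[of s] by (simp add: sum.atLeast_Suc_atMost)
qed

text \<open>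
  The differences \<open>\<epsilon>\<close> telescope, and the levels missing from the enumeration contribute 0. For
  \<open>s = k j + 1\<close> this shows that the rows of \<open>C\<^sub>j\<close> start at row \<open>\<omega> (k j + 1)\<close> of \<open>C\<close>.
\<close>

lemma sum_eps_levels:
  assumes "1 \<le> s" "s \<le> \<mu> + 1"
  shows "(\<Sum>l \<in> {l \<in> {1..g}. s \<le> k l}. \<epsilon> (k l)) = \<omega> s"
proof -
  have "inj_on k {1..g}"
    using k_antimono by (intro linorder_inj_onI) force+
  then have "inj_on k {l \<in> {1..g}. s \<le> k l}" by (rule inj_on_subset) auto
  then have "(\<Sum>l \<in> {l \<in> {1..g}. s \<le> k l}. \<epsilon> (k l)) = (\<Sum>t \<in> k ` {l \<in> {1..g}. s \<le> k l}. \<epsilon> t)"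
    by (simp add: sum.reindex)
  also have "k ` {l \<in> {1..g}. s \<le> k l} = {t \<in> k ` {1..g}. s \<le> t}" by blast
  also have "\<dots> = {t \<in> {s..\<mu>}. 0 < \<epsilon> t}"
    unfolding k_image using assms by auto
  also have "(\<Sum>t \<in> {t \<in> {s..\<mu>}. 0 < \<epsilon> t}. \<epsilon> t) = (\<Sum>t\<in>{s..\<mu>}. \<epsilon> t)"
    by (intro sum.mono_neutral_left) auto
  finally show ?thesis using sum_eps[OF assms] by simp
qed

lemma row_offset:
  assumes j: "j \<in> {1..g}"
  shows "(\<Sum>l\<in>{1..<j}. \<epsilon> (k l)) = \<omega> (k j + 1)"
proof -
  have "{1..<j} = {l \<in> {1..g}. k j + 1 \<le> k l}"
    using k_less_iff[OF _ j] j by fastforce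
  then show ?thesis using sum_eps_levels[of "k j + 1"] k_range[OF j] by simp
qed

lemma row_total: "(\<Sum>l\<in>{1..<g + 1}. \<epsilon> (k l)) = m"
proof -
  have "{1..<g + 1} = {l \<in> {1..g}. 1 \<le> k l}" using k_range by fastforce
  then show ?thesis using sum_eps_levels[of 1] omega_1 by simp
qed

lemma row_in_level:
  assumes "i < m"
  obtains j r where "j \<in> {1..g}" "r < \<epsilon> (k j)" "i = \<omega> (k j + 1) + r"
proof -
  obtain t where t: "t \<in> {1..\<mu>}" "\<omega> (t + 1) \<le> i" "i < \<omega> t" using row_level_exists[OF assms] .
  then obtain j where j: "j \<in> {1..g}" "k j = t" using k_hits[of t] by auto
  show thesis using that[of j "i - \<omega> (k j + 1)"] j t eps_eq[of t] by simp
qed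

definition level_rows :: "(nat \<Rightarrow> real mat) \<Rightarrow> (nat \<Rightarrow> real mat) \<Rightarrow> nat \<Rightarrow> real mat" where
  "level_rows Sr Sf j = 0\<^sub>m (\<epsilon> (k j)) (\<Sum>i=1..k j-1. \<omega> i) @\<^sub>c Sr (k j) @\<^sub>c Sf (k j)"

lemma width_split:
  assumes "t \<in> {1..\<mu>}"
  shows "n = offs \<omega> t + (\<omega> t + (\<Sum>i=t+1..\<mu>. \<omega> i))"
proof -
  have "{1..\<mu>} = {1..<t} \<union> {t..\<mu>}" using assms by auto
  then have "n = sum \<omega> {1..<t} + sum \<omega> {t..\<mu>}"
    unfolding sum_omega[symmetric] by (simp add: sum.union_disjoint ivl_disj_int)
  then show ?thesis using assms by (simp add: offs_def sum.atLeast_Suc_atMost)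
qed

lemma sum_before: "1 \<le> t \<Longrightarrow> (\<Sum>i=1..t-1. \<omega> i) = offs \<omega> t"
  unfolding offs_def by (intro sum.cong) auto

lemma level_rows_carrier:
  assumes j: "j \<in> {1..g}" and Sr: "Sr (k j) \<in> carrier_mat (\<epsilon> (k j)) (\<omega> (k j))"
    and Sf: "Sf (k j) \<in> carrier_mat (\<epsilon> (k j)) (\<Sum>i=k j+1..\<mu>. \<omega> i)"
  shows "level_rows Sr Sf j \<in> carrier_mat (\<epsilon> (k j)) n"
  unfolding level_rows_def width_split[OF k_range[OF j]]
  using sum_before[of "k j"] k_range[OF j] Sr Sf by (intro carrier_append_cols) auto

lemma level_rows_index:
  assumes j: "j \<in> {1..g}" and Sr: "Sr (k j) \<in> carrier_mat (\<epsilon> (k j)) (\<omega> (k j))"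
    and Sf: "Sf (k j) \<in> carrier_mat (\<epsilon> (k j)) (\<Sum>i=k j+1..\<mu>. \<omega> i)"
    and r: "r < \<epsilon> (k j)" and c: "c < n"
  shows "level_rows Sr Sf j $$ (r, c) =
    (if c < offs \<omega> (k j) then 0
     else if c < offs \<omega> (k j + 1) then Sr (k j) $$ (r, c - offs \<omega> (k j))
     else Sf (k j) $$ (r, c - offs \<omega> (k j + 1)))"
proof -
  let ?t = "k j"
  have t: "?t \<in> {1..\<mu>}" using k_range[OF j] .
  have Z: "0\<^sub>m (\<epsilon> ?t) (\<Sum>i=1..?t-1. \<omega> i) = (0\<^sub>m (\<epsilon> ?t) (offs \<omega> ?t) :: real mat)"
    using sum_before[of ?t] t by simp
  note inner = carrier_append_cols[OF Sr Sf]
  have c': "c < offs \<omega> ?t + (\<omega> ?t + (\<Sum>i=?t+1..\<mu>. \<omega> i))" using c width_split[OF t] by simp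
  show ?thesis
    unfolding level_rows_def Z
    using r c' offs_Suc[of ?t] t
    by (subst index_append_cols[OF zero_carrier_mat inner r c'])
       (auto simp: index_append_cols[OF Sr Sf r])
qed

text \<open>
  Comparing entries, the parameters are determined by \<open>C\<close>: \<open>Sr (k j)\<close> has to be
  \<open>lead_part C (k j)\<close>, and \<open>Sf (k j)\<close> is whatever stands to the right of it. So the parametrized
  matrices are those with the prescribed zeros whose bordered blocks are nonsingular.
\<close>

lemma parametrized_iff:
  "(\<exists>Sr Sf.
      (\<forall>j\<in>{1..g}. Sr (k j) \<in> carrier_mat (\<epsilon> (k j)) (\<omega> (k j))) \<and>
      (\<forall>j\<in>{1..g}. Sf (k j) \<in> carrier_mat (\<epsilon> (k j)) (\<Sum>i=k j+1..\<mu>. \<omega> i)) \<and>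
      invertible_mat (Sr (k 1)) \<and>
      (\<forall>j\<in>{2..g}. invertible_mat (block \<omega> A (k j + 1) (k j) @\<^sub>r Sr (k j))) \<and>
      C = stack_rows n (map (level_rows Sr Sf) [1..<g+1])) \<longleftrightarrow>
    C \<in> carrier_mat m n \<and> prefix_zero C \<and> (\<forall>t\<in>{1..\<mu>}. det (bordered_block C t) \<noteq> 0)"
  (is "?L \<longleftrightarrow> ?R")
proof -
  have inv: "invertible_mat (bordered_block C t) \<longleftrightarrow> det (bordered_block C t) \<noteq> 0"
    if "t \<in> {1..\<mu>}" for t
    using bordered_block_carrier[OF that] by (rule invertible_mat_iff_det)
  have top: "bordered_block C \<mu> = lead_part C \<mu>"
  proof (rule eq_matI)
    fix i j assume "i < dim_row (lead_part C \<mu>)" "j < dim_col (lead_part C \<mu>)"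
    then show "bordered_block C \<mu> $$ (i, j) = lead_part C \<mu> $$ (i, j)"
      unfolding bordered_block_def using omega_beyond
      by (subst index_append_rows[OF block_carrier lead_part_carrier]) (auto simp: lead_part_def)
  qed (use bordered_block_carrier[of \<mu> C] lead_part_carrier[of C \<mu>] mu_pos omega_beyond in auto)
  have stack:
    "stack_rows n (map (level_rows Sr Sf) [1..<g+1]) \<in> carrier_mat m n \<and>
     (\<forall>j\<in>{1..g}. \<forall>r<\<epsilon> (k j). \<forall>c<n.
        stack_rows n (map (level_rows Sr Sf) [1..<g+1]) $$ (\<omega> (k j + 1) + r, c) =
        level_rows Sr Sf j $$ (r, c))"
    if "\<forall>j\<in>{1..g}. Sr (k j) \<in> carrier_mat (\<epsilon> (k j)) (\<omega> (k j))"
       "\<forall>j\<in>{1..g}. Sf (k j) \<in> carrier_mat (\<epsilon> (k j)) (\<Sum>i=k j+1..\<mu>. \<omega> i)" for Sr Sf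
  proof -
    have car: "level_rows Sr Sf l \<in> carrier_mat (\<epsilon> (k l)) n" if "l \<in> {1..<g+1}" for l
      using level_rows_carrier[of l Sr Sf] that \<open>\<forall>j\<in>_. Sr _ \<in> _\<close> \<open>\<forall>j\<in>_. Sf _ \<in> _\<close> by auto
    let ?M = "stack_rows n (map (level_rows Sr Sf) [1..<g+1])"
    have rows: "?M \<in> carrier_mat (\<Sum>l\<in>{1..<g+1}. \<epsilon> (k l)) n \<and>
      (\<forall>j\<in>{1..<g+1}. \<forall>r<\<epsilon> (k j). \<forall>c<n.
         ?M $$ ((\<Sum>l\<in>{1..<j}. \<epsilon> (k l)) + r, c) = level_rows Sr Sf j $$ (r, c))"
      by (rule stack_rows_upt[OF car le_add2])
    show ?thesis
    proof (intro conjI ballI allI impI)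
      show "?M \<in> carrier_mat m n"
        using rows unfolding row_total by blast
      fix j r c assume j: "j \<in> {1..g}" and rc: "r < \<epsilon> (k j)" "c < n"
      then have "j \<in> {1..<g+1}" by simp
      from rows[THEN conjunct2, rule_format, OF this rc]
      show "?M $$ (\<omega> (k j + 1) + r, c) = level_rows Sr Sf j $$ (r, c)"
        unfolding row_offset[OF j] .
    qed
  qed
  show ?thesis
  proof
    assume ?L
    then obtain Sr Sf where
      Sr: "\<forall>j\<in>{1..g}. Sr (k j) \<in> carrier_mat (\<epsilon> (k j)) (\<omega> (k j))" and
      Sf: "\<forall>j\<in>{1..g}. Sf (k j) \<in> carrier_mat (\<epsilon> (k j)) (\<Sum>i=k j+1..\<mu>. \<omega> i)" and
      inv1: "invertible_mat (Sr (k 1))" and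
      invj: "\<forall>j\<in>{2..g}. invertible_mat (block \<omega> A (k j + 1) (k j) @\<^sub>r Sr (k j))" and
      C: "C = stack_rows n (map (level_rows Sr Sf) [1..<g+1])" by blast
    have ent: "C $$ (\<omega> (k j + 1) + r, c) =
       (if c < offs \<omega> (k j) then 0
        else if c < offs \<omega> (k j + 1) then Sr (k j) $$ (r, c - offs \<omega> (k j))
        else Sf (k j) $$ (r, c - offs \<omega> (k j + 1)))"
      if "j \<in> {1..g}" "r < \<epsilon> (k j)" "c < n" for j r c
      using stack[OF Sr Sf] level_rows_index[of j Sr Sf r c] Sr Sf that unfolding C by auto
    have z: "prefix_zero C"
      unfolding prefix_zero_def
    proof (intro ballI allI impI)
      fix t i q assume t: "t \<in> {1..\<mu>}" and i: "i \<in> {\<omega> (t + 1)..<\<omega> t}" and q: "q < offs \<omega> t"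
      then obtain j where j: "j \<in> {1..g}" "k j = t" using k_hits[of t] by auto
      then show "C $$ (i, q) = 0"
        using ent[of j "i - \<omega> (t + 1)" q] i q eps_eq[OF t] offs_le_n[of t] t by auto
    qed
    have lead: "lead_part C (k j) = Sr (k j)" if j: "j \<in> {1..g}" for j
    proof (rule eq_matI)
      have t: "k j \<in> {1..\<mu>}" using k_range[OF j] .
      have S: "Sr (k j) \<in> carrier_mat (\<omega> (k j) - \<omega> (k j + 1)) (\<omega> (k j))"
        using bspec[OF Sr j] unfolding eps_eq[OF t] .
      then show "dim_row (lead_part C (k j)) = dim_row (Sr (k j))"
        "dim_col (lead_part C (k j)) = dim_col (Sr (k j))"
        by (auto simp: lead_part_def)
      fix r c assume "r < dim_row (Sr (k j))" "c < dim_col (Sr (k j))"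
      then have rc: "r < \<omega> (k j) - \<omega> (k j + 1)" "c < \<omega> (k j)" using S by auto
      then show "lead_part C (k j) $$ (r, c) = Sr (k j) $$ (r, c)"
        using ent[OF j, of r "offs \<omega> (k j) + c"] eps_eq[OF t] offs_Suc[of "k j"]
          offs_le_n[of "k j + 1"] t by (simp add: lead_part_def)
    qed
    have "det (bordered_block C t) \<noteq> 0" if t: "t \<in> {1..\<mu>}" for t
    proof (cases "\<omega> (t + 1) = \<omega> t")
      case True
      then show ?thesis by (rule det_bordered_block_flat[OF t])
    next
      case False
      then have "\<omega> (t + 1) < \<omega> t" using t omega_antimono[of t "t + 1"] by simp
      then obtain j where j: "j \<in> {1..g}" "k j = t" using k_hits[OF t] by blast
      show ?thesis
      proof (cases "j = 1")
        case True
        then show ?thesis using inv1 inv[OF t] lead[OF j(1)] top k_1 j by simp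
      next
        case False
        then show ?thesis using invj inv[OF t] lead[OF j(1)] j by (auto simp: bordered_block_def)
      qed
    qed
    then show ?R using z stack[OF Sr Sf] C by blast
  next
    assume R: ?R
    define Sf where "Sf t = mat (\<epsilon> t) (\<Sum>i=t+1..\<mu>. \<omega> i)
      (\<lambda>(r, c). C $$ (\<omega> (t + 1) + r, offs \<omega> (t + 1) + c))" for t
    have Sr: "\<forall>j\<in>{1..g}. lead_part C (k j) \<in> carrier_mat (\<epsilon> (k j)) (\<omega> (k j))"
      using lead_part_carrier eps_eq[OF k_range] by metis
    have Sf: "\<forall>j\<in>{1..g}. Sf (k j) \<in> carrier_mat (\<epsilon> (k j)) (\<Sum>i=k j+1..\<mu>. \<omega> i)"
      by (simp add: Sf_def)
    let ?M = "stack_rows n (map (level_rows (lead_part C) Sf) [1..<g+1])"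
    have M: "?M \<in> carrier_mat m n" using stack[OF Sr Sf] by blast
    have "C = ?M"
    proof (rule eq_matI)
      show "dim_row C = dim_row ?M" "dim_col C = dim_col ?M"
        using R carrier_matD[OF M] by auto
      fix i c assume "i < dim_row ?M" "c < dim_col ?M"
      then have i: "i < m" and c: "c < n" using carrier_matD[OF M] by auto
      obtain j r where j: "j \<in> {1..g}" and r: "r < \<epsilon> (k j)" and ir: "i = \<omega> (k j + 1) + r"
        using row_in_level[OF i] .
      have t: "k j \<in> {1..\<mu>}" using k_range[OF j] .
      have "?M $$ (i, c) = level_rows (lead_part C) Sf j $$ (r, c)"
        using stack[OF Sr Sf] j r c ir by blast
      also have "\<dots> = (if c < offs \<omega> (k j) then 0
        else if c < offs \<omega> (k j + 1) then lead_part C (k j) $$ (r, c - offs \<omega> (k j))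
        else Sf (k j) $$ (r, c - offs \<omega> (k j + 1)))"
        using Sr Sf j r c by (intro level_rows_index) auto
      also have "\<dots> = C $$ (i, c)"
        using R t r c ir offs_Suc[of "k j"] eps_eq[OF t] width_split[OF t]
        by (auto simp: prefix_zero_def lead_part_def Sf_def)
      finally show "C $$ (i, c) = ?M $$ (i, c)" by simp
    qed
    moreover have "invertible_mat (lead_part C (k 1))"
    proof -
      have "invertible_mat (bordered_block C \<mu>)" using R inv[of \<mu>] mu_pos by simp
      then show ?thesis using top k_1 by simp
    qed
    moreover have "\<forall>j\<in>{2..g}. invertible_mat (block \<omega> A (k j + 1) (k j) @\<^sub>r lead_part C (k j))"
      using R inv k_range by (auto simp: bordered_block_def)
    ultimately show ?L using Sr Sf by blast
  qed
qed

end

theorem theorem1: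
  fixes n m \<mu> g :: nat
    and \<omega> k \<epsilon> :: "nat \<Rightarrow> nat"
    and A B :: "real mat"
  assumes "1 \<le> m" and "m \<le> n"
    and "staircase_form n m \<mu> \<omega> A B"
    and "\<omega> (\<mu> + 1) = 0"
    and "\<And>i. i \<in> {1..\<mu>} \<Longrightarrow> \<epsilon> i = \<omega> i - \<omega> (i + 1)"
    and "\<And>j. j \<in> {1..<g} \<Longrightarrow> k (j + 1) < k j"
    and "k ` {1..g} = {i \<in> {1..\<mu>}. 0 < \<epsilon> i}"
  shows
    "{C \<in> carrier_mat m n.
        decouplable n m A B C \<and>
        (\<forall>i<m. decoupling_index n m A B C i = controllability_indices n m A B ! i)} =
     {C. \<exists>Sr Sf.
        (\<forall>j\<in>{1..g}. Sr (k j) \<in> carrier_mat (\<epsilon> (k j)) (\<omega> (k j))) \<and>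
        (\<forall>j\<in>{1..g}. Sf (k j) \<in> carrier_mat (\<epsilon> (k j)) (\<Sum>i=k j+1..\<mu>. \<omega> i)) \<and>
        invertible_mat (Sr (k 1)) \<and>
        (\<forall>j\<in>{2..g}. invertible_mat (block \<omega> A (k j + 1) (k j) @\<^sub>r Sr (k j))) \<and>
        C = stack_rows n
              (map (\<lambda>j. 0\<^sub>m (\<epsilon> (k j)) (\<Sum>i=1..k j-1. \<omega> i) @\<^sub>c Sr (k j) @\<^sub>c Sf (k j)) [1..<g+1])}"
proof -
  interpret staircase_levels n m \<mu> \<omega> A B g k \<epsilon>
    using assms by unfold_locales
  have level: "level_rows Sr Sf =
      (\<lambda>j. 0\<^sub>m (\<epsilon> (k j)) (\<Sum>i=1..k j-1. \<omega> i) @\<^sub>c Sr (k j) @\<^sub>c Sf (k j))" for Sr Sf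
    by (rule ext) (rule level_rows_def)
  show ?thesis
    unfolding parametrized_iff[unfolded level] by (rule Collect_cong) (use decoupled_iff in blast)
qed

end
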